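(* Let $E_u$ be a Dedekind complete Riesz space with strong order unit $u$, and let $T$ be a strictly positive conditional expectation on $E_u$ with $Tu=u$. Let $X_1,\dots,X_n$ be $T$-conditionally independent elements of $E_u$ such that $X_i\in[a_iu,b_iu]$ for all $1\le i\le n$, where $a_i\neq b_i$ are real scalars. Then for every real $t>0$, $$TP_{\left(\sum_{i=1}^n(X_i-T(X_i))-tu\right)^+}u\;\leq\;\exp\left(-\frac{2t^2}{\sum_{i=1}^n(b_i-a_i)^2}\right)u.$$
   Context: $E_u$ is a Dedekind complete Riesz space with strong order unit $u$. By the Yosida representation theorem there are a compact Hausdorff space $K$ and a Riesz isomorphism $\varphi:E_u\to C(K)$ with $\varphi(u)=1$; $E_u$ carries the $f$-algebra multiplication transported by $\varphi$, for which $u$ is the unit. Here $[a_iu,b_iu]=\{x\in E_u: a_iu\le x\le b_iu\}$ is the order interval. A conditional expectation $T$ is a positive order continuous linear projection mapping weak order units to weak order units whose range $R(T)$ is a Dedekind complete Riesz subspace. It is strictly positive if $T|x|=0$ implies $x=0$. For $x\in E_u$, $P_{x^+}$ is the band projection onto the band generated by $x^+$. Independence: band projections $P,Q$ are $T$-conditionally independent if $TPQu=TPu\cdot TQu$. Two Riesz subspaces $E_1,E_2$ are $T$-conditionally independent if all band projections $P_1,P_2$ with $P_iu\in E_i$ are $T$-conditionally independent. A family $(E_\lambda)_{\lambda\in\Lambda}$ of (order) closed Riesz subspaces containing $R(T)$ is $T$-conditionally independent if for every pair of disjoint subsets $\Lambda_1,\Lambda_2\subset\Lambda$ the closed Riesz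 subspaces generated by $\bigcup_{\lambda\in\Lambda_1}E_\lambda$ and by $\bigcup_{\lambda\in\Lambda_2}E_\lambda$ are $T$-conditionally independent. Elements $(X_i)$ are $T$-conditionally independent if the family of closed Riesz subspaces $\langle\{X_i\}\cup R(T)\rangle$ generated by $X_i$ and $R(T)$ is. *)

theory Defs
  imports "HOL-Analysis.Analysis" "HOL-Library.Lattice_Algebras"
begin

section \<open>Dedekind complete Riesz spaces\<close>

text \<open>
  A Riesz space is a whole type. The class \<open>lattice_ab_group_add_abs\<close> contributes the modulus
  \<open>\<bar>x\<bar> = sup x (- x)\<close> and the positive part \<open>pprt x = sup x 0\<close>.
\<close>

class riesz_space = ordered_real_vector + lattice_ab_group_add_abs

class dedekind_complete_riesz_space = riesz_space + conditionally_complete_lattice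

definition strong_order_unit :: "'a::riesz_space \<Rightarrow> bool" where
  "strong_order_unit u \<longleftrightarrow> 0 \<le> u \<and> (\<forall>x. \<exists>c::real. \<bar>x\<bar> \<le> c *\<^sub>R u)"

definition weak_order_unit :: "'a::riesz_space \<Rightarrow> bool" where
  "weak_order_unit e \<longleftrightarrow> 0 \<le> e \<and> (\<forall>x. inf \<bar>x\<bar> e = 0 \<longrightarrow> x = 0)"

definition riesz_subspace :: "'a::riesz_space set \<Rightarrow> bool" where
  "riesz_subspace S \<longleftrightarrow> subspace S \<and> (\<forall>x\<in>S. \<forall>y\<in>S. sup x y \<in> S \<and> inf x y \<in> S)"

text \<open>
  Here suprema are taken inside \<open>S\<close>; they need not be suprema in the ambient space.
\<close>

definition dedekind_complete_on :: "'a::riesz_space set \<Rightarrow> bool" where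
  "dedekind_complete_on S \<longleftrightarrow>
     (\<forall>A. A \<subseteq> S \<and> A \<noteq> {} \<and> (\<exists>b\<in>S. \<forall>a\<in>A. a \<le> b) \<longrightarrow>
        (\<exists>s\<in>S. (\<forall>a\<in>A. a \<le> s) \<and> (\<forall>b\<in>S. (\<forall>a\<in>A. a \<le> b) \<longrightarrow> s \<le> b)))"


section \<open>Order convergence\<close>

text \<open>
  Nets are represented by filters. The set \<open>D\<close> is the range of a net decreasing to \<open>0\<close> (with its
  own index set), each term of which eventually dominates \<open>\<bar>f i - l\<bar>\<close>.
\<close>

definition decreases_to_zero :: "'a::dedekind_complete_riesz_space set \<Rightarrow> bool" where
  "decreases_to_zero D \<longleftrightarrow>
     D \<noteq> {} \<and> (\<forall>d\<in>D. 0 \<le> d) \<and> (\<forall>d\<in>D. \<forall>e\<in>D. \<exists>c\<in>D. c \<le> d \<and> c \<le> e) \<and> Inf D = 0"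

definition order_tendsto ::
    "('i \<Rightarrow> 'a::dedekind_complete_riesz_space) \<Rightarrow> 'a \<Rightarrow> 'i filter \<Rightarrow> bool" where
  "order_tendsto f l F \<longleftrightarrow>
     (\<exists>D. decreases_to_zero D \<and> (\<forall>d\<in>D. eventually (\<lambda>i. \<bar>f i - l\<bar> \<le> d) F))"

text \<open>
  A net \<open>f\<close> order converges to \<open>l\<close> along \<open>F\<close> iff the identity does along \<open>filtermap f F\<close>, so filters
  on the space itself account for all nets, whatever their index type.
\<close>

definition order_continuous ::
    "('a::dedekind_complete_riesz_space \<Rightarrow> 'b::dedekind_complete_riesz_space) \<Rightarrow> bool" where
  "order_continuous T \<longleftrightarrow>
     (\<forall>F x. order_tendsto (\<lambda>y. y) x F \<longrightarrow> order_tendsto T (T x) F)"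

definition order_closed :: "'a::dedekind_complete_riesz_space set \<Rightarrow> bool" where
  "order_closed S \<longleftrightarrow>
     (\<forall>F x. F \<noteq> bot \<and> eventually (\<lambda>y. y \<in> S) F \<and> order_tendsto (\<lambda>y. y) x F \<longrightarrow> x \<in> S)"

definition closed_riesz_subspace :: "'a::dedekind_complete_riesz_space set \<Rightarrow> bool" where
  "closed_riesz_subspace S \<longleftrightarrow> riesz_subspace S \<and> order_closed S"

definition generated_subspace :: "'a::dedekind_complete_riesz_space set \<Rightarrow> 'a set" where
  "generated_subspace A = closed_riesz_subspace hull A"


section \<open>Bands and band projections\<close>

definition band :: "'a::dedekind_complete_riesz_space set \<Rightarrow> bool" where
  "band B \<longleftrightarrow> subspace B \<and> (\<forall>x y. y \<in> B \<and> \<bar>x\<bar> \<le> \<bar>y\<bar> \<longrightarrow> x \<in> B) \<and> order_closed B"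

definition generated_band :: "'a::dedekind_complete_riesz_space \<Rightarrow> 'a set" where
  "generated_band x = band hull {x}"

text \<open>
  The projection along the decomposition of the space into \<open>B\<close> and its disjoint complement.
\<close>

definition band_proj ::
    "'a::dedekind_complete_riesz_space set \<Rightarrow> 'a \<Rightarrow> 'a" where
  "band_proj B x = (THE y. y \<in> B \<and> (\<forall>b\<in>B. inf \<bar>x - y\<bar> \<bar>b\<bar> = 0))"

definition band_projection :: "('a::dedekind_complete_riesz_space \<Rightarrow> 'a) \<Rightarrow> bool" where
  "band_projection P \<longleftrightarrow> (\<exists>B. band B \<and> P = band_proj B)"


section \<open>The f-algebra multiplication\<close>

text \<open>
  \<open>yosida_representation u K \<phi>\<close>: \<open>K\<close> is a compact Hausdorff space and \<open>\<phi>\<close> is a Riesz isomorphism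
  onto the continuous real functions on \<open>K\<close> sending \<open>u\<close> to the constant function \<open>1\<close>. Only the
  values of \<open>\<phi> x\<close> on \<open>topspace K\<close> are relevant.
\<close>

definition yosida_representation ::
    "'a::riesz_space \<Rightarrow> 'k topology \<Rightarrow> ('a \<Rightarrow> 'k \<Rightarrow> real) \<Rightarrow> bool" where
  "yosida_representation u K \<phi> \<longleftrightarrow>
     compact_space K \<and> Hausdorff_space K \<and>
     (\<forall>x. continuous_map K euclideanreal (\<phi> x)) \<and>
     (\<forall>f. continuous_map K euclideanreal f \<longrightarrow> (\<exists>x. \<forall>k\<in>topspace K. \<phi> x k = f k)) \<and>
     (\<forall>x y. (\<forall>k\<in>topspace K. \<phi> x k = \<phi> y k) \<longrightarrow> x = y) \<and>
     (\<forall>k\<in>topspace K.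
        (\<forall>x y. \<phi> (x + y) k = \<phi> x k + \<phi> y k) \<and>
        (\<forall>c x. \<phi> (c *\<^sub>R x) k = c * \<phi> x k) \<and>
        (\<forall>x y. \<phi> (sup x y) k = max (\<phi> x k) (\<phi> y k)) \<and>
        (\<forall>x y. \<phi> (inf x y) k = min (\<phi> x k) (\<phi> y k)) \<and>
        \<phi> u k = 1)"

text \<open>
  The multiplication carried over from pointwise multiplication of functions. It does not depend
  on the representation, because Riesz isomorphisms of function spaces that preserve \<open>1\<close> are
  multiplicative. Taking the points of \<open>K\<close> in the type \<open>'a \<Rightarrow> real\<close> loses no generality: in any
  representation a point \<open>k\<close> may be replaced by the evaluation \<open>\<lambda>x. \<phi> x k\<close>.
\<close>

definition f_mult :: "'a::riesz_space \<Rightarrow> 'a \<Rightarrow> 'a \<Rightarrow> 'a" where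
  "f_mult u x y =
     (THE z. \<exists>(K :: ('a \<Rightarrow> real) topology) \<phi>. yosida_representation u K \<phi> \<and>
        (\<forall>k\<in>topspace K. \<phi> z k = \<phi> x k * \<phi> y k))"


section \<open>Conditional expectations and conditional independence\<close>

definition conditional_expectation :: "('a::dedekind_complete_riesz_space \<Rightarrow> 'a) \<Rightarrow> bool" where
  "conditional_expectation T \<longleftrightarrow>
     linear T \<and> (\<forall>x\<ge>0. 0 \<le> T x) \<and> order_continuous T \<and> (\<forall>x. T (T x) = T x) \<and>
     (\<forall>e. weak_order_unit e \<longrightarrow> weak_order_unit (T e)) \<and>
     riesz_subspace (range T) \<and> dedekind_complete_on (range T)"

definition strictly_positive :: "('a::riesz_space \<Rightarrow> 'a) \<Rightarrow> bool" where
  "strictly_positive T \<longleftrightarrow> (\<forall>x. T \<bar>x\<bar> = 0 \<longrightarrow> x = 0)"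

definition cond_indep_projections ::
    "'a::dedekind_complete_riesz_space \<Rightarrow> ('a \<Rightarrow> 'a) \<Rightarrow> ('a \<Rightarrow> 'a) \<Rightarrow> ('a \<Rightarrow> 'a) \<Rightarrow> bool" where
  "cond_indep_projections u T P Q \<longleftrightarrow> T (P (Q u)) = f_mult u (T (P u)) (T (Q u))"

definition cond_indep_subspaces ::
    "'a::dedekind_complete_riesz_space \<Rightarrow> ('a \<Rightarrow> 'a) \<Rightarrow> 'a set \<Rightarrow> 'a set \<Rightarrow> bool" where
  "cond_indep_subspaces u T E1 E2 \<longleftrightarrow>
     (\<forall>P Q. band_projection P \<and> band_projection Q \<and> P u \<in> E1 \<and> Q u \<in> E2 \<longrightarrow>
        cond_indep_projections u T P Q)"

definition cond_indep_family ::
    "'a::dedekind_complete_riesz_space \<Rightarrow> ('a \<Rightarrow> 'a) \<Rightarrow> 'i set \<Rightarrow> ('i \<Rightarrow> 'a set) \<Rightarrow> bool" where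
  "cond_indep_family u T \<Lambda> E \<longleftrightarrow>
     (\<forall>i\<in>\<Lambda>. closed_riesz_subspace (E i) \<and> range T \<subseteq> E i) \<and>
     (\<forall>\<Lambda>1 \<Lambda>2. \<Lambda>1 \<subseteq> \<Lambda> \<and> \<Lambda>2 \<subseteq> \<Lambda> \<and> \<Lambda>1 \<inter> \<Lambda>2 = {} \<longrightarrow>
        cond_indep_subspaces u T
          (generated_subspace (\<Union>i\<in>\<Lambda>1. E i)) (generated_subspace (\<Union>i\<in>\<Lambda>2. E i)))"

definition cond_indep_elements ::
    "'a::dedekind_complete_riesz_space \<Rightarrow> ('a \<Rightarrow> 'a) \<Rightarrow> 'i set \<Rightarrow> ('i \<Rightarrow> 'a) \<Rightarrow> bool" where
  "cond_indep_elements u T I X \<longleftrightarrow>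
     cond_indep_family u T I (\<lambda>i. generated_subspace ({X i} \<union> range T))"

end

theory Submission
  imports Defs "HOL-Probability.Hoeffding"
begin

text \<open>
  Real-valued Riesz homomorphisms \<open>k\<close> with \<open>k u = 1\<close> (characters) separate points, so inequalities
  and products can be checked pointwise on the compact space of characters, as in \<open>C(K)\<close>.
  Elements of a closed Riesz subspace are uniform limits of combinations of components of \<open>u\<close> lying
  in it. Hence independence, which only speaks about band projections, extends to
  \<open>T (x y) = T x T y\<close> for arbitrary elements, and \<open>T\<close> is \<open>R(T)\<close>-linear. The inequality then follows
  from Chernoff's argument: the projection of \<open>u\<close> is at most \<open>exp (l (S - t u))\<close>, and
  \<open>T (exp (l (X\<^sub>i - T X\<^sub>i))) \<le> exp (l\<^sup>2 (b\<^sub>i - a\<^sub>i)\<^sup>2 / 8) u\<close> is proved as Hoeffding's lemma, replacing the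
  exponential by its chord over \<open>[a\<^sub>i, b\<^sub>i]\<close>. The optimal parameter is \<open>l = 4 t / (\<Sum>i. (b\<^sub>i - a\<^sub>i)\<^sup>2)\<close>.
\<close>

section \<open>Characters of a Dedekind complete Riesz space with strong unit\<close>

text \<open>The product in the independence hypothesis is a definite description over all Yosida
  representations whose points have type \<open>'a \<Rightarrow> real\<close>. It is usable only
  once such a representation exists and all of them are known to give the same product, so the
  Yosida theorem itself has to be established; its points are produced from maximal order ideals. A
  second obstacle shapes the rest: evaluation at a character does not commute with infinite suprema
  in general. The values of a supremum are therefore not computed as limits. They are squeezed
  between members of the set and upper bounds constructed for the purpose. This is how components
  turn out to take only the values 0 and 1, how continuous functions are realised by elements, and
  how closed Riesz subspaces are seen to contain exponentials.\<close>

lemma abs_scaleR_le: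
  fixes x :: "'a::riesz_space"
  shows "\<bar>c *\<^sub>R x\<bar> \<le> \<bar>c\<bar> *\<^sub>R \<bar>x\<bar>"
proof -
  have p: "d *\<^sub>R y \<le> \<bar>d\<bar> *\<^sub>R \<bar>y\<bar>" for d and y :: 'a
  proof (cases "d \<ge> 0")
    case True
    then show ?thesis by (simp only: abs_of_nonneg) (intro scaleR_left_mono abs_ge_self)
  next
    case False
    then have "(-d) *\<^sub>R (- y) \<le> (-d) *\<^sub>R \<bar>y\<bar>"
      using False by (intro scaleR_left_mono abs_ge_minus_self) auto
    with False show ?thesis by simp
  qed
  have "- (c *\<^sub>R x) \<le> \<bar>c\<bar> *\<^sub>R \<bar>x\<bar>"
    using p[of c "- x"] by simp
  with p[of c x] show ?thesis
    by (simp add: abs_le_iff)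
qed

lemma inf_pprt_uminus:
  fixes x :: "'a::riesz_space"
  shows "inf (pprt x) (pprt (- x)) = 0"
proof -
  have "pprt x = x + pprt (- x)"
    by (simp add: pprt_def add_sup_distrib_left sup_commute)
  then have "inf (pprt x) (pprt (- x)) = inf (x + pprt (- x)) (0 + pprt (- x))"
    by simp
  also have "\<dots> = inf x 0 + pprt (- x)"
    by (simp only: add_inf_distrib_right)
  also have "inf x 0 = - pprt (- x)"
    by (simp add: pprt_def neg_sup_eq_inf)
  finally show ?thesis by simp
qed

text \<open>Division by \<open>M\<close> moves both bounds under \<open>inf x y\<close>. The ideal
  arguments below exploit disjointness through this estimate.\<close>

lemma le_zero_if_scaled_le:
  fixes x y z :: "'a::riesz_space"
  assumes "inf x y = 0" "0 < M" "z \<le> M *\<^sub>R x" "z \<le> M *\<^sub>R y"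
  shows "z \<le> 0"
proof -
  have "(1/M) *\<^sub>R z \<le> (1/M) *\<^sub>R (M *\<^sub>R x)" "(1/M) *\<^sub>R z \<le> (1/M) *\<^sub>R (M *\<^sub>R y)"
    using assms by (intro scaleR_left_mono; simp)+
  then have "(1/M) *\<^sub>R z \<le> inf x y" using assms by (intro inf_greatest) simp_all
  then have "(1/M) *\<^sub>R z \<le> 0" using assms by simp
  then have "M *\<^sub>R ((1/M) *\<^sub>R z) \<le> M *\<^sub>R 0"
    using assms by (intro scaleR_left_mono) auto
  with assms show ?thesis by simp
qed

lemma abs_sup_diff_le:
  fixes a b c d :: "'a::riesz_space"
  shows "\<bar>sup a b - sup c d\<bar> \<le> \<bar>a - c\<bar> + \<bar>b - d\<bar>"
proof -
  have *: "sup p q \<le> sup r s + (\<bar>p - r\<bar> + \<bar>q - s\<bar>)" for p q r s :: 'a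
  proof (rule sup_least)
    have "p \<le> r + \<bar>p - r\<bar>"
      by (metis abs_ge_self add.commute diff_le_eq)
    also have "\<dots> \<le> sup r s + (\<bar>p - r\<bar> + \<bar>q - s\<bar>)"
      by (intro add_mono) auto
    finally show "p \<le> sup r s + (\<bar>p - r\<bar> + \<bar>q - s\<bar>)" .
    have "q \<le> s + \<bar>q - s\<bar>"
      by (metis abs_ge_self add.commute diff_le_eq)
    also have "\<dots> \<le> sup r s + (\<bar>p - r\<bar> + \<bar>q - s\<bar>)"
      by (intro add_mono) auto
    finally show "q \<le> sup r s + (\<bar>p - r\<bar> + \<bar>q - s\<bar>)" .
  qed
  show ?thesis
    using *[of a b c d] *[of c d a b]
    unfolding abs_le_iff minus_diff_eq diff_le_eq
    by (simp only: abs_minus_commute add.commute)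
qed

text \<open>Dedekind completeness supplies the Archimedean property: the multiples of
  \<open>x\<close> are bounded by \<open>y\<close>, and with each multiple \<open>z\<close> also
  \<open>z + x\<close> is one, so their supremum lowered by \<open>x\<close> is still an upper
  bound.\<close>

lemma archimedean_le_zero:
  fixes x y :: "'a::dedekind_complete_riesz_space"
  assumes "\<And>e::real. 0 < e \<Longrightarrow> x \<le> e *\<^sub>R y"
  shows "x \<le> 0"
proof -
  have le: "real (Suc n) *\<^sub>R x \<le> y" for n
  proof -
    have "real (Suc n) *\<^sub>R x \<le> real (Suc n) *\<^sub>R ((1 / real (Suc n)) *\<^sub>R y)"
      by (intro scaleR_left_mono assms) auto
    then show ?thesis by simp
  qed
  define A where "A = range (\<lambda>n. real (Suc n) *\<^sub>R x)"
  have bdd: "bdd_above A" unfolding A_def using le by (auto intro!: bdd_aboveI)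
  have "Sup A \<le> Sup A - x"
  proof (rule cSup_least)
    show "A \<noteq> {}" by (auto simp: A_def)
    fix z assume "z \<in> A"
    then obtain n where z: "z = real (Suc n) *\<^sub>R x" by (auto simp: A_def)
    have "real (Suc (Suc n)) *\<^sub>R x \<le> Sup A"
      using bdd unfolding A_def by (intro cSup_upper rangeI)
    moreover have "real (Suc (Suc n)) *\<^sub>R x = z + x"
      unfolding z of_nat_Suc[of "Suc n"] by (simp only: scaleR_add_left scaleR_one add.commute)
    ultimately show "z \<le> Sup A - x" by (simp add: algebra_simps)
  qed
  then show ?thesis by simp
qed

section \<open>Order ideals, the maximal ones being kernels of characters\<close>

definition order_ideal :: "'a::riesz_space set \<Rightarrow> bool" where
  "order_ideal I \<longleftrightarrow> subspace I \<and> (\<forall>x y. y \<in> I \<and> \<bar>x\<bar> \<le> \<bar>y\<bar> \<longrightarrow> x \<in> I)"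

lemma order_ideal_subspace: "order_ideal I \<Longrightarrow> subspace I"
  by (simp add: order_ideal_def)

lemma order_ideal_solid: "order_ideal I \<Longrightarrow> y \<in> I \<Longrightarrow> \<bar>x\<bar> \<le> \<bar>y\<bar> \<Longrightarrow> x \<in> I"
  unfolding order_ideal_def by blast

lemma order_ideal_abs: "order_ideal I \<Longrightarrow> x \<in> I \<Longrightarrow> \<bar>x\<bar> \<in> I"
  by (erule order_ideal_solid) auto

lemma order_ideal_between:
  "order_ideal I \<Longrightarrow> y \<in> I \<Longrightarrow> 0 \<le> x \<Longrightarrow> x \<le> y \<Longrightarrow> x \<in> I"
  by (erule order_ideal_solid) auto

text \<open>\<open>J\<close> is the ideal generated by \<open>I\<close> and \<open>y\<close>. The
  explicit domination is what matters later: once \<open>u\<close> falls into \<open>J\<close>, it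
  is bounded by an element of \<open>I\<close> plus a multiple of \<open>y\<close>.\<close>

lemma order_ideal_extend:
  assumes I: "order_ideal I" and y: "(0::'a::riesz_space) \<le> y"
  defines "J \<equiv> {x. \<exists>i\<in>I. \<exists>m\<ge>0. \<bar>x\<bar> \<le> i + m *\<^sub>R y}"
  shows "order_ideal J" "I \<subseteq> J" "y \<in> J"
proof -
  note sub = order_ideal_subspace[OF I]
  show "I \<subseteq> J"
    unfolding J_def using order_ideal_abs[OF I] by (auto intro!: bexI exI[of _ "0::real"])
  show "y \<in> J"
    unfolding J_def using y subspace_0[OF sub] by (auto intro!: bexI[of _ 0] exI[of _ "1::real"])
  show "order_ideal J"
    unfolding order_ideal_def
  proof (intro conjI allI impI subspaceI)
    show "0 \<in> J" using \<open>I \<subseteq> J\<close> subspace_0[OF sub] by blast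
  next
    fix x x' assume "x \<in> J" "x' \<in> J"
    then obtain i m i' m' where *: "i \<in> I" "m \<ge> 0" "\<bar>x\<bar> \<le> i + m *\<^sub>R y"
      "i' \<in> I" "m' \<ge> 0" "\<bar>x'\<bar> \<le> i' + m' *\<^sub>R y"
      unfolding J_def by auto
    have "\<bar>x + x'\<bar> \<le> \<bar>x\<bar> + \<bar>x'\<bar>" by (rule abs_triangle_ineq)
    also have "\<dots> \<le> (i + m *\<^sub>R y) + (i' + m' *\<^sub>R y)"
      using * by (intro add_mono)
    also have "\<dots> = (i + i') + (m + m') *\<^sub>R y" by (simp add: algebra_simps)
    finally show "x + x' \<in> J"
      unfolding J_def using * subspace_add[OF sub, of i i'] by (auto intro!: bexI exI[of _ "m + m'"])
  next
    fix c :: real and x assume "x \<in> J"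
    then obtain i m where *: "i \<in> I" "m \<ge> 0" "\<bar>x\<bar> \<le> i + m *\<^sub>R y"
      unfolding J_def by auto
    have "\<bar>c *\<^sub>R x\<bar> \<le> \<bar>c\<bar> *\<^sub>R \<bar>x\<bar>" by (rule abs_scaleR_le)
    also have "\<dots> \<le> \<bar>c\<bar> *\<^sub>R (i + m *\<^sub>R y)" using * by (intro scaleR_left_mono) auto
    also have "\<dots> = \<bar>c\<bar> *\<^sub>R i + (\<bar>c\<bar> * m) *\<^sub>R y" by (simp add: scaleR_add_right)
    finally show "c *\<^sub>R x \<in> J"
      unfolding J_def using * subspace_scale[OF sub, of i "\<bar>c\<bar>"]
      by (auto intro!: bexI exI[of _ "\<bar>c\<bar> * m"])
  next
    fix x z assume "z \<in> J \<and> \<bar>x\<bar> \<le> \<bar>z\<bar>"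
    then show "x \<in> J" unfolding J_def by (auto intro: order_trans)
  qed
qed

text \<open>In \<open>C(K)\<close> these are the point evaluations. As a subset of
  \<open>'a \<Rightarrow> real\<close> the set inherits the topology of pointwise convergence, and
  its elements have exactly the type of points that \<open>f_mult\<close> asks for.\<close>

definition riesz_characters :: "'a::riesz_space \<Rightarrow> ('a \<Rightarrow> real) set" where
  "riesz_characters u = {k.
     (\<forall>x y. k (x + y) = k x + k y) \<and> (\<forall>c x. k (c *\<^sub>R x) = c * k x) \<and>
     (\<forall>x y. k (sup x y) = max (k x) (k y)) \<and> (\<forall>x y. k (inf x y) = min (k x) (k y)) \<and>
     k u = 1}"

locale strong_unit =
  fixes u :: "'a::dedekind_complete_riesz_space"
  assumes unit: "strong_order_unit u"
begin

lemma unit_nonneg: "0 \<le> u"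
  using unit by (simp add: strong_order_unit_def)

lemma unit_bound:
  obtains c where "0 < c" "\<bar>x\<bar> \<le> c *\<^sub>R u"
proof -
  obtain c where c: "\<bar>x\<bar> \<le> c *\<^sub>R u"
    using unit unfolding strong_order_unit_def by blast
  have "c *\<^sub>R u \<le> (\<bar>c\<bar> + 1) *\<^sub>R u"
    using unit_nonneg by (intro scaleR_right_mono) auto
  with c have "\<bar>x\<bar> \<le> (\<bar>c\<bar> + 1) *\<^sub>R u" by (rule order_trans)
  then show ?thesis by (intro that[of "\<bar>c\<bar> + 1"]) auto
qed

context
  fixes I :: "'a set"
  assumes ideal: "order_ideal I" and proper: "u \<notin> I"
    and maximal: "\<And>J. order_ideal J \<Longrightarrow> I \<subseteq> J \<Longrightarrow> u \<notin> J \<Longrightarrow> J = I"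
begin

lemma maximal_ideal_unit:
  assumes "0 \<le> y" "y \<notin> I"
  obtains i m where "i \<in> I" "0 < m" "u \<le> i + m *\<^sub>R y"
proof -
  define J where "J = {x. \<exists>i\<in>I. \<exists>m\<ge>0. \<bar>x\<bar> \<le> i + m *\<^sub>R y}"
  have "order_ideal J" "I \<subseteq> J" "y \<in> J"
    using order_ideal_extend[OF ideal assms(1)] by (simp_all add: J_def)
  with maximal assms have "u \<in> J" by blast
  then obtain i m where *: "i \<in> I" "0 \<le> m" "\<bar>u\<bar> \<le> i + m *\<^sub>R y"
    unfolding J_def by blast
  have "m *\<^sub>R y \<le> (m + 1) *\<^sub>R y" using assms by (intro scaleR_right_mono) auto
  with * have "u \<le> i + (m + 1) *\<^sub>R y" 
    using unit_nonneg by (metis abs_of_nonneg add_left_mono order_trans)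
  with * show ?thesis by (intro that[of i "m + 1"]) auto
qed

text \<open>If both were outside \<open>I\<close>, maximality would put \<open>u\<close> below
  \<open>s + (m + l) x\<close> and below \<open>s + (m + l) y\<close> for some \<open>s\<close> in
  \<open>I\<close>. Disjointness then leaves \<open>u \<le> s\<close>, contradicting
  properness.\<close>

lemma maximal_ideal_prime:
  assumes "inf x y = 0"
  shows "x \<in> I \<or> y \<in> I"
proof (rule ccontr)
  assume "\<not> ?thesis"
  moreover have nn: "0 \<le> x" "0 \<le> y" using assms by (metis inf.cobounded1 inf.cobounded2)+
  ultimately obtain i m j l where *: "i \<in> I" "0 < m" "u \<le> i + m *\<^sub>R x"
    "j \<in> I" "0 < l" "u \<le> j + l *\<^sub>R y"
    using maximal_ideal_unit by metis
  define s where "s = \<bar>i\<bar> + \<bar>j\<bar>"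
  have s: "s \<in> I" using * order_ideal_abs[OF ideal] order_ideal_subspace[OF ideal]
    by (auto simp: s_def intro: subspace_add)
  have "i \<le> s" "j \<le> s" 
    unfolding s_def by (simp_all add: add_increasing add_increasing2 add_nonneg_nonneg order_trans[OF abs_ge_self])
  moreover have "m *\<^sub>R x \<le> (m + l) *\<^sub>R x" "l *\<^sub>R y \<le> (m + l) *\<^sub>R y"
    using nn * by (auto intro!: scaleR_right_mono)
  ultimately have "u \<le> s + (m + l) *\<^sub>R x" "u \<le> s + (m + l) *\<^sub>R y"
    using * by (meson add_mono order_trans)+
  then have "u - s \<le> 0"
    using * by (intro le_zero_if_scaled_le[OF assms, of "m + l"]) (auto simp: algebra_simps)
  then have "u \<in> I" using order_ideal_between[OF ideal s unit_nonneg] by simp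
  with proper show False by simp
qed

text \<open>For \<open>y\<close> outside \<open>I\<close> some \<open>i + m y\<close> dominates
  \<open>u\<close>. Approximating \<open>y\<close> within \<open>1 / (2 m)\<close> uses up only half
  of \<open>u\<close>, so the other half would lie in \<open>I\<close>.\<close>

lemma maximal_ideal_closed:
  assumes "0 \<le> y" "\<And>e. 0 < e \<Longrightarrow> \<exists>i\<in>I. y \<le> e *\<^sub>R u + i"
  shows "y \<in> I"
proof (rule ccontr)
  assume "y \<notin> I"
  then obtain i m where i: "i \<in> I" "0 < m" "u \<le> i + m *\<^sub>R y"
    using maximal_ideal_unit assms(1) by blast
  obtain j where j: "j \<in> I" "y \<le> (1 / (2 * m)) *\<^sub>R u + j"
    using assms(2)[of "1 / (2 * m)"] i by auto
  have "m *\<^sub>R y \<le> m *\<^sub>R ((1 / (2 * m)) *\<^sub>R u + j)"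
    using i j by (intro scaleR_left_mono) auto
  then have "u \<le> i + ((1/2) *\<^sub>R u + m *\<^sub>R j)"
    using i by (simp add: scaleR_add_right) (meson add_left_mono order_trans)
  then have "u - (1/2) *\<^sub>R u \<le> i + m *\<^sub>R j" by (simp add: algebra_simps)
  moreover have "u = (1/2) *\<^sub>R u + (1/2) *\<^sub>R u" by (simp flip: scaleR_add_left)
  then have "u - (1/2) *\<^sub>R u = (1/2) *\<^sub>R u" by (metis add_diff_cancel_right')
  ultimately have "(1/2) *\<^sub>R u \<le> i + m *\<^sub>R j" by metis
  then have "2 *\<^sub>R ((1/2) *\<^sub>R u) \<le> 2 *\<^sub>R (i + m *\<^sub>R j)" by (intro scaleR_left_mono) auto
  then have "u \<le> 2 *\<^sub>R (i + m *\<^sub>R j)" by simp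
  moreover have "2 *\<^sub>R (i + m *\<^sub>R j) \<in> I"
    using i j order_ideal_subspace[OF ideal] by (intro subspace_scale subspace_add)
  ultimately have "u \<in> I" using order_ideal_between[OF ideal _ unit_nonneg] by blast
  with proper show False by simp
qed

text \<open>The quotient by \<open>I\<close> is totally ordered by primeness and Archimedean by
  closedness, hence one-dimensional. The scalar is a Dedekind cut: the supremum of all
  \<open>c\<close> for which the positive part of \<open>c u - x\<close> lies in
  \<open>I\<close>.\<close>

lemma maximal_ideal_scalar: "\<exists>c. x - c *\<^sub>R u \<in> I"
proof -
  note sub = order_ideal_subspace[OF ideal]
  obtain M where M: "0 < M" "\<bar>x\<bar> \<le> M *\<^sub>R u" using unit_bound .
  then have Mx: "x \<le> M *\<^sub>R u" "- M *\<^sub>R u \<le> x" by (auto simp: abs_le_iff minus_le_iff)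
  define A where "A = {c. pprt (c *\<^sub>R u - x) \<in> I}"
  have "pprt (- M *\<^sub>R u - x) = 0" using Mx by simp
  then have ne: "- M \<in> A" using subspace_0[OF sub] by (simp add: A_def)
  have ub: "c \<le> M" if "c \<in> A" for c
  proof (rule ccontr)
    assume "\<not> c \<le> M"
    then have cM: "c - M > 0" by simp
    have "(c - M) *\<^sub>R u \<le> c *\<^sub>R u - x" using Mx by (simp add: algebra_simps)
    also have "\<dots> \<le> pprt (c *\<^sub>R u - x)" by (simp add: pprt_def)
    finally have "(1/(c-M)) *\<^sub>R ((c - M) *\<^sub>R u) \<le> (1/(c-M)) *\<^sub>R pprt (c *\<^sub>R u - x)"
      using cM by (intro scaleR_left_mono) auto
    then have "u \<le> (1/(c-M)) *\<^sub>R pprt (c *\<^sub>R u - x)" using cM by simp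
    moreover have "(1/(c-M)) *\<^sub>R pprt (c *\<^sub>R u - x) \<in> I"
      using that sub by (auto simp: A_def intro: subspace_scale)
    ultimately show False using proper order_ideal_between[OF ideal _ unit_nonneg] by blast
  qed
  then have bdd: "bdd_above A" by (rule bdd_aboveI)
  define c where "c = Sup A"
  have "\<bar>x - c *\<^sub>R u\<bar> \<in> I"
  proof (rule maximal_ideal_closed)
    fix e :: real assume e: "0 < e"
    obtain d where d: "d \<in> A" "c - e < d"
      using less_cSupE[of "c - e" A] e ne unfolding c_def by auto
    \<comment> \<open>Above the cut the positive part of \<open>(c + e) u - x\<close> is outside
      \<open>I\<close>, so primeness puts the opposite part into \<open>I\<close>; just below the
      cut, \<open>d\<close> gives the reverse bound.\<close>
    have "c + e \<notin> A" using cSup_upper[OF _ bdd, of "c + e"] e by (auto simp: c_def)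
    moreover have "inf (pprt (x - (c + e) *\<^sub>R u)) (pprt ((c + e) *\<^sub>R u - x)) = 0"
      using inf_pprt_uminus[of "x - (c + e) *\<^sub>R u"] by simp
    ultimately have i1: "pprt (x - (c + e) *\<^sub>R u) \<in> I"
      using maximal_ideal_prime unfolding A_def by blast
    have i2: "pprt (d *\<^sub>R u - x) \<in> I" using d by (simp add: A_def)
    let ?i = "pprt (x - (c + e) *\<^sub>R u) + pprt (d *\<^sub>R u - x)"
    have "x - (c + e) *\<^sub>R u \<le> ?i" by (intro add_increasing2) (auto simp: pprt_def)
    then have "x - c *\<^sub>R u \<le> e *\<^sub>R u + ?i" by (simp add: algebra_simps)
    moreover have "d *\<^sub>R u - x \<le> ?i" by (intro add_increasing) (auto simp: pprt_def)
    then have "- (x - c *\<^sub>R u) \<le> (c - d) *\<^sub>R u + ?i" by (simp add: algebra_simps)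
    then have "- (x - c *\<^sub>R u) \<le> e *\<^sub>R u + ?i"
      using d unit_nonneg by (smt (verit) add_right_mono order_trans scaleR_right_mono)
    ultimately have "\<bar>x - c *\<^sub>R u\<bar> \<le> e *\<^sub>R u + ?i" by (simp add: abs_le_iff)
    then show "\<exists>i\<in>I. \<bar>x - c *\<^sub>R u\<bar> \<le> e *\<^sub>R u + i"
      using i1 i2 sub subspace_add by blast
  qed auto
  then have "x - c *\<^sub>R u \<in> I" by (rule order_ideal_solid[OF ideal]) auto
  then show ?thesis ..
qed

text \<open>The value \<open>k x\<close> is the only scalar for which \<open>x - (k x) u\<close>
  lies in \<open>I\<close>, since \<open>u\<close> does not. The homomorphism identities follow
  because \<open>I\<close> is a subspace and, for suprema, because it is solid.\<close>

lemma maximal_ideal_character: "\<exists>k\<in>riesz_characters u. \<forall>x\<in>I. k x = 0"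
proof -
  note sub = order_ideal_subspace[OF ideal]
  define k where "k x = (SOME c. x - c *\<^sub>R u \<in> I)" for x
  have k: "x - k x *\<^sub>R u \<in> I" for x
    unfolding k_def using maximal_ideal_scalar by (rule someI_ex)
  have k_eqI: "k x = c" if "x - c *\<^sub>R u \<in> I" for x c
  proof (rule ccontr)
    assume ne: "k x \<noteq> c"
    have "(x - c *\<^sub>R u) - (x - k x *\<^sub>R u) \<in> I"
      by (rule subspace_diff[OF sub that k])
    then have "(1 / (k x - c)) *\<^sub>R ((x - c *\<^sub>R u) - (x - k x *\<^sub>R u)) \<in> I"
      using sub by (intro subspace_scale)
    also have "(x - c *\<^sub>R u) - (x - k x *\<^sub>R u) = (k x - c) *\<^sub>R u" by (simp add: algebra_simps)
    finally show False using proper ne by simp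
  qed
  have add: "k (x + y) = k x + k y" for x y
    using subspace_add[OF sub k[of x] k[of y]] by (intro k_eqI) (simp add: algebra_simps)
  have scale: "k (c *\<^sub>R x) = c * k x" for c x
    using subspace_scale[OF sub k[of x], of c] by (intro k_eqI) (simp add: algebra_simps)
  have sup: "k (sup x y) = max (k x) (k y)" for x y
  proof (rule k_eqI)
    have "\<bar>sup x y - sup (k x *\<^sub>R u) (k y *\<^sub>R u)\<bar> \<le> \<bar>x - k x *\<^sub>R u\<bar> + \<bar>y - k y *\<^sub>R u\<bar>"
      by (rule abs_sup_diff_le)
    also have "\<dots> = \<bar>\<bar>x - k x *\<^sub>R u\<bar> + \<bar>y - k y *\<^sub>R u\<bar>\<bar>" by simp
    finally have "sup x y - sup (k x *\<^sub>R u) (k y *\<^sub>R u) \<in> I"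
      using k sub order_ideal_abs[OF ideal] order_ideal_solid[OF ideal] by (meson subspace_add)
    moreover have "sup (k x *\<^sub>R u) (k y *\<^sub>R u) = max (k x) (k y) *\<^sub>R u"
      using scaleR_right_mono[OF _ unit_nonneg]
      by (metis max.cobounded1 max.cobounded2 max_def sup.order_iff sup_absorb2)
    ultimately show "sup x y - max (k x) (k y) *\<^sub>R u \<in> I" by simp
  qed
  have neg: "k (- x) = - k x" for x using scale[of "-1"] by simp
  have inf: "k (inf x y) = min (k x) (k y)" for x y
  proof -
    have "k (inf x y) = - max (- k x) (- k y)" unfolding inf_eq_neg_sup neg sup ..
    then show ?thesis by (simp add: max_def min_def)
  qed
  have "k u = 1" by (rule k_eqI) (simp add: subspace_0[OF sub])
  then have "k \<in> riesz_characters u" by (simp add: riesz_characters_def add scale sup inf)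
  moreover have "k x = 0" if "x \<in> I" for x by (rule k_eqI) (simp add: that)
  ultimately show ?thesis by blast
qed

end

text \<open>A character that kills \<open>w\<close> is what is wanted: then
  \<open>max (e - k x) 0 = 0\<close>, which forces \<open>k x\<close> to be at least
  \<open>e\<close>. It comes from a maximal ideal containing \<open>w\<close> and missing
  \<open>u\<close>, found by Zorn's lemma.\<close>

lemma character_positive:
  assumes "\<not> x \<le> 0"
  shows "\<exists>k\<in>riesz_characters u. 0 < k x"
proof -
  obtain e where e: "0 < e" "\<not> x \<le> e *\<^sub>R u"
    using archimedean_le_zero[of x u] assms by blast
  define w where "w = pprt (e *\<^sub>R u - x)"
  define z where "z = pprt (x - e *\<^sub>R u)"
  have wz: "inf w z = 0" using inf_pprt_uminus[of "e *\<^sub>R u - x"] by (simp add: w_def z_def)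
  have w0: "0 \<le> w" and z0: "0 \<le> z" by (simp_all add: w_def z_def)
  define I0 where "I0 = {x. \<exists>i\<in>{0::'a}. \<exists>m\<ge>0. \<bar>x\<bar> \<le> i + m *\<^sub>R w}"
  have "order_ideal {0::'a}" by (auto simp: order_ideal_def)
  from order_ideal_extend[OF this w0] have I0: "order_ideal I0" "w \<in> I0" by (simp_all add: I0_def)
  \<comment> \<open>A multiple of \<open>w\<close> dominating \<open>u\<close> would yield one
    dominating \<open>z\<close>; being disjoint from \<open>w\<close>, the element \<open>z\<close>
    would vanish, against the choice of \<open>e\<close>.\<close>
  have uI0: "u \<notin> I0"
  proof
    assume "u \<in> I0"
    then obtain m where m: "0 \<le> m" "u \<le> m *\<^sub>R w" using unit_nonneg by (auto simp: I0_def)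
    obtain c where c: "0 < c" "\<bar>z\<bar> \<le> c *\<^sub>R u" using unit_bound .
    have "z \<le> c *\<^sub>R u" using c z0 by simp
    also have "\<dots> \<le> c *\<^sub>R (m *\<^sub>R w)" using m c by (intro scaleR_left_mono) auto
    also have "\<dots> \<le> (1 + c * m) *\<^sub>R w" using w0 by (simp add: scaleR_add_left)
    finally have "z \<le> (1 + c * m) *\<^sub>R w" .
    moreover have "z \<le> (1 + c * m) *\<^sub>R z"
      using z0 c m by (simp add: scaleR_add_left scaleR_nonneg_nonneg)
    ultimately have "z \<le> 0"
      using c m by (intro le_zero_if_scaled_le[OF wz, of "1 + c * m"]) (auto simp: add_pos_nonneg)
    moreover have "x - e *\<^sub>R u \<le> z" by (simp add: z_def pprt_def)
    ultimately show False using e by (metis diff_le_0_iff_le order_trans)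
  qed
  define C where "C = {I. order_ideal I \<and> w \<in> I \<and> u \<notin> I}"
  have "\<exists>I\<in>C. \<forall>J\<in>C. I \<subseteq> J \<longrightarrow> J = I"
  proof (rule subset_Zorn_nonempty)
    show "C \<noteq> {}" using I0 uI0 by (auto simp: C_def)
    fix \<C> assume ne: "\<C> \<noteq> {}" and ch: "subset.chain C \<C>"
    have mem: "order_ideal J" "w \<in> J" "u \<notin> J" if "J \<in> \<C>" for J
      using ch that by (auto simp: C_def subset.chain_def)
    have "subspace (\<Union>\<C>)"
    proof (rule subspaceI)
      show "0 \<in> \<Union>\<C>" using ne mem(1) order_ideal_subspace subspace_0 by blast
      fix x y assume "x \<in> \<Union>\<C>" "y \<in> \<Union>\<C>"
      then obtain J J' where J: "J \<in> \<C>" "x \<in> J" "J' \<in> \<C>" "y \<in> J'" by blast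
      with ch have "J \<subseteq> J' \<or> J' \<subseteq> J" unfolding subset.chain_def by blast
      then show "x + y \<in> \<Union>\<C>" using J mem(1) order_ideal_subspace subspace_add by blast
    next
      fix c :: real and x assume "x \<in> \<Union>\<C>"
      then show "c *\<^sub>R x \<in> \<Union>\<C>" using mem(1) order_ideal_subspace subspace_scale by blast
    qed
    then have "order_ideal (\<Union>\<C>)" using mem(1) unfolding order_ideal_def by blast
    then show "\<Union>\<C> \<in> C" using ne mem by (auto simp: C_def)
  qed
  then obtain I where "I \<in> C" and max: "\<And>J. J \<in> C \<Longrightarrow> I \<subseteq> J \<Longrightarrow> J = I" by blast
  then have I: "order_ideal I" "w \<in> I" "u \<notin> I" by (auto simp: C_def)
  have "\<exists>k\<in>riesz_characters u. \<forall>x\<in>I. k x = 0"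
    using I max by (intro maximal_ideal_character) (auto simp: C_def)
  then obtain k where k: "k \<in> riesz_characters u" "k w = 0" using I by blast
  have "e *\<^sub>R u - x = e *\<^sub>R u + (-1) *\<^sub>R x" by simp
  then have "k (e *\<^sub>R u - x) = e - k x" using k(1) 
    unfolding riesz_characters_def mem_Collect_eq by (metis diff_conv_add_uminus mult.right_neutral mult_minus1)
  moreover have "k 0 = 0" using k(1) unfolding riesz_characters_def mem_Collect_eq
    by (metis mult_zero_left scaleR_zero_left)
  ultimately have "k w = max (e - k x) 0"
    using k(1) unfolding w_def pprt_def riesz_characters_def by simp
  with k e have "0 < k x" by (auto simp: max_def split: if_splits)
  with k(1) show ?thesis by blast
qed

end

section \<open>The Yosida representation\<close>

text \<open>Order is recovered from \<open>inf x y = x\<close>, as the representation is injective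
  and preserves infima.\<close>

lemma yosida_representation_le_iff:
  assumes "yosida_representation u K \<phi>"
  shows "x \<le> y \<longleftrightarrow> (\<forall>k\<in>topspace K. \<phi> x k \<le> \<phi> y k)"
proof -
  have inf: "\<phi> (inf x y) k = min (\<phi> x k) (\<phi> y k)" if "k \<in> topspace K" for k
    using assms that unfolding yosida_representation_def by blast
  have "inf x y = x \<longleftrightarrow> (\<forall>k\<in>topspace K. \<phi> (inf x y) k = \<phi> x k)"
    using assms unfolding yosida_representation_def by metis
  also have "\<dots> \<longleftrightarrow> (\<forall>k\<in>topspace K. \<phi> x k \<le> \<phi> y k)"
    using inf by (auto simp: min_def)
  finally show ?thesis by (simp add: le_iff_inf)
qed

lemma yosida_representation_diff:
  assumes "yosida_representation u K \<phi>" "k \<in> topspace K"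
  shows "\<phi> (x - y) k = \<phi> x k - \<phi> y k"
proof -
  have "\<phi> (x + (-1) *\<^sub>R y) k = \<phi> x k + (-1) * \<phi> y k"
    using assms unfolding yosida_representation_def by metis
  then show ?thesis by simp
qed

text \<open>
  The square of \<open>x\<close> is the supremum of the tangents \<open>2 c x - c\<^sup>2 u\<close>, which makes it independent of
  the representation; products follow by polarization.
\<close>

lemma yosida_square_least:
  assumes rep: "yosida_representation u K \<phi>"
    and s: "\<And>k. k \<in> topspace K \<Longrightarrow> \<phi> s k = (\<phi> x k)\<^sup>2"
  shows "(\<forall>c. (2 * c) *\<^sub>R x - c\<^sup>2 *\<^sub>R u \<le> w) \<longleftrightarrow> s \<le> w"
proof -
  have tangent: "\<phi> ((2 * c) *\<^sub>R x - c\<^sup>2 *\<^sub>R u) k = 2 * c * \<phi> x k - c\<^sup>2" if "k \<in> topspace K" for c k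
    using rep that yosida_representation_diff[OF rep that]
    unfolding yosida_representation_def by simp
  have *: "(\<forall>c. 2 * c * r - c\<^sup>2 \<le> d) \<longleftrightarrow> r\<^sup>2 \<le> d" for r d :: real
  proof
    assume "\<forall>c. 2 * c * r - c\<^sup>2 \<le> d"
    from this[rule_format, of r] show "r\<^sup>2 \<le> d" by (simp add: power2_eq_square)
  next
    assume d: "r\<^sup>2 \<le> d"
    show "\<forall>c. 2 * c * r - c\<^sup>2 \<le> d"
    proof
      fix c
      have "0 \<le> (r - c)\<^sup>2" by simp
      then show "2 * c * r - c\<^sup>2 \<le> d" using d by (simp add: power2_diff mult.commute mult.left_commute)
    qed
  qed
  show ?thesis
    unfolding yosida_representation_le_iff[OF rep] using * by (auto simp: tangent s)
qed

text \<open>The squares of \<open>x + y\<close> and \<open>x - y\<close> are determined by the order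
  of the Riesz space, so both representations agree on them without any map between \<open>K\<close>
  and \<open>K'\<close>. This makes the description behind \<open>f_mult\<close>
  unambiguous.\<close>

lemma yosida_product_unique:
  assumes rep: "yosida_representation u K \<phi>" and rep': "yosida_representation u K' \<psi>"
    and z: "\<And>k. k \<in> topspace K \<Longrightarrow> \<phi> z k = \<phi> x k * \<phi> y k"
    and z': "\<And>k. k \<in> topspace K' \<Longrightarrow> \<psi> z' k = \<psi> x k * \<psi> y k"
  shows "z = z'"
proof -
  have square: "\<exists>s. \<forall>k\<in>topspace L. \<rho> s k = (\<rho> v k)\<^sup>2" if "yosida_representation u L \<rho>" for L \<rho> v
  proof -
    have "continuous_map L euclideanreal (\<lambda>k. (\<rho> v k)\<^sup>2)"
      using that unfolding yosida_representation_def by (intro continuous_map_real_pow) auto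
    then show ?thesis using that unfolding yosida_representation_def by meson
  qed
  have unique: "s = s'"
    if "\<forall>k\<in>topspace K. \<phi> s k = (\<phi> v k)\<^sup>2" "\<forall>k\<in>topspace K'. \<psi> s' k = (\<psi> v k)\<^sup>2" for s s' v
    using yosida_square_least[OF rep, of s v] yosida_square_least[OF rep', of s' v] that
    by (meson order.refl order.antisym)
  have polar: "4 *\<^sub>R p = s1 - s2"
    if L: "yosida_representation u L \<rho>" and p: "\<And>k. k \<in> topspace L \<Longrightarrow> \<rho> p k = \<rho> x k * \<rho> y k"
      and s1: "\<forall>k\<in>topspace L. \<rho> s1 k = (\<rho> (x + y) k)\<^sup>2"
      and s2: "\<forall>k\<in>topspace L. \<rho> s2 k = (\<rho> (x - y) k)\<^sup>2" for L \<rho> p s1 s2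
  proof -
    have "\<rho> (4 *\<^sub>R p) k = \<rho> (s1 - s2) k" if k: "k \<in> topspace L" for k
    proof -
      have "\<rho> (4 *\<^sub>R p) k = 4 * (\<rho> x k * \<rho> y k)" "\<rho> (x + y) k = \<rho> x k + \<rho> y k"
        using L k p unfolding yosida_representation_def by auto
      then show ?thesis
        using s1 s2 k
        by (simp add: yosida_representation_diff[OF L k] power2_eq_square algebra_simps)
    qed
    then show ?thesis using L unfolding yosida_representation_def by blast
  qed
  obtain s1 s2 where s: "\<forall>k\<in>topspace K. \<phi> s1 k = (\<phi> (x + y) k)\<^sup>2"
    "\<forall>k\<in>topspace K. \<phi> s2 k = (\<phi> (x - y) k)\<^sup>2" using square[OF rep] by metis
  obtain s1' s2' where s': "\<forall>k\<in>topspace K'. \<psi> s1' k = (\<psi> (x + y) k)\<^sup>2"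
    "\<forall>k\<in>topspace K'. \<psi> s2' k = (\<psi> (x - y) k)\<^sup>2" using square[OF rep'] by metis
  have "4 *\<^sub>R z = s1 - s2" using polar[OF rep z s] .
  also have "\<dots> = s1' - s2'" using unique s s' by blast
  also have "\<dots> = 4 *\<^sub>R z'" using polar[OF rep' z' s'] by simp
  finally show ?thesis by simp
qed

section \<open>The compact space of characters and its continuous functions\<close>

context strong_unit
begin

abbreviation \<Delta> where "\<Delta> \<equiv> riesz_characters u"

lemma character_add: "k \<in> \<Delta> \<Longrightarrow> k (x + y) = k x + k y"
  and character_scale: "k \<in> \<Delta> \<Longrightarrow> k (c *\<^sub>R x) = c * k x"
  and character_sup: "k \<in> \<Delta> \<Longrightarrow> k (sup x y) = max (k x) (k y)"
  and character_inf: "k \<in> \<Delta> \<Longrightarrow> k (inf x y) = min (k x) (k y)"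
  and character_unit: "k \<in> \<Delta> \<Longrightarrow> k u = 1"
  by (auto simp: riesz_characters_def)

lemma character_zero: "k \<in> \<Delta> \<Longrightarrow> k 0 = 0"
  using character_scale[of k 0 0] by simp

lemma character_minus: "k \<in> \<Delta> \<Longrightarrow> k (- x) = - k x"
  using character_scale[of k "-1" x] by simp

lemma character_diff: "k \<in> \<Delta> \<Longrightarrow> k (x - y) = k x - k y"
  using character_add[of k x "- y"] by (simp add: character_minus)

lemma character_abs: "k \<in> \<Delta> \<Longrightarrow> k \<bar>x\<bar> = \<bar>k x\<bar>"
  by (simp only: abs_lattice[of x] character_sup character_minus abs_real_def max_def)
    (auto split: if_splits)

lemma character_pprt: "k \<in> \<Delta> \<Longrightarrow> k (pprt x) = max (k x) 0"
  by (simp add: pprt_def character_sup character_zero)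

lemmas character_simps = character_add character_scale character_sup character_inf character_unit
  character_zero character_minus character_diff character_abs character_pprt

lemma le_iff_characters: "x \<le> y \<longleftrightarrow> (\<forall>k\<in>\<Delta>. k x \<le> k y)"
proof
  assume "x \<le> y"
  then show "\<forall>k\<in>\<Delta>. k x \<le> k y" by (metis character_sup max.cobounded1 sup_absorb2)
next
  assume *: "\<forall>k\<in>\<Delta>. k x \<le> k y"
  then have "x - y \<le> 0" using character_positive[of "x - y"] by (fastforce simp: character_simps)
  then show "x \<le> y" by simp
qed

lemma character_mono: "k \<in> \<Delta> \<Longrightarrow> x \<le> y \<Longrightarrow> k x \<le> k y"
  using le_iff_characters by blast

lemma eq_characters: "(\<And>k. k \<in> \<Delta> \<Longrightarrow> k x = k y) \<Longrightarrow> x = y"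
  by (metis le_iff_characters order.antisym order.refl)

lemma continuous_on_characters [continuous_intros]: "continuous_on \<Delta> (\<lambda>k. k x)"
  by (rule continuous_on_subset[OF continuous_on_product_coordinates]) simp

text \<open>As in the Banach-Alaoglu theorem: \<open>k u = 1\<close> and the bound of
  \<open>x\<close> by a multiple of \<open>u\<close> confine \<open>k x\<close> to an interval, so
  the characters lie in a compact product. They are cut out by pointwise identities, which are
  closed conditions.\<close>

lemma compact_characters: "compact \<Delta>"
proof -
  have "\<exists>c. \<bar>x\<bar> \<le> c *\<^sub>R u" for x using unit_bound[of x] by blast
  then obtain c where c: "\<And>x. \<bar>x\<bar> \<le> c x *\<^sub>R u" by metis
  define P where "P = Pi\<^sub>E (UNIV :: 'a set) (\<lambda>x. {- c x .. c x})"
  have "compactin (product_topology (\<lambda>_. euclidean) UNIV) P"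
    unfolding P_def by (simp add: compactin_PiE)
  then have "compact P" by (simp add: euclidean_product_topology)
  moreover have "closed \<Delta>"
    unfolding riesz_characters_def
    by (intro closed_Collect_conj closed_Collect_all closed_Collect_eq continuous_intros
        continuous_on_product_coordinates)
  moreover have "\<Delta> \<subseteq> P"
  proof
    fix k assume k: "k \<in> \<Delta>"
    have "\<bar>k x\<bar> \<le> c x" for x
      using character_mono[OF k c[of x]] k by (simp add: character_simps)
    then have "- c x \<le> k x \<and> k x \<le> c x" for x by (meson abs_le_iff minus_le_iff)
    then show "k \<in> P" by (auto simp: P_def)
  qed
  ultimately show ?thesis by (metis compact_Int_closed inf_absorb2)
qed

lemma characters_separate:
  assumes "p \<in> \<Delta>" "q \<in> \<Delta>"
  shows "\<exists>x. p x = f p \<and> q x = f q"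
proof (cases "p = q")
  case True
  with assms show ?thesis by (intro exI[of _ "f p *\<^sub>R u"]) (simp add: character_simps)
next
  case False
  then obtain y where y: "p y \<noteq> q y" by (auto simp: fun_eq_iff)
  define x where "x = f q *\<^sub>R u + ((f p - f q) / (p y - q y)) *\<^sub>R (y - q y *\<^sub>R u)"
  have "p x = f p" "q x = f q"
    using assms y by (simp_all add: x_def character_simps)
  then show ?thesis by blast
qed

text \<open>Half of the lattice Stone-Weierstrass argument. An interpolant of \<open>f\<close> at
  \<open>p\<close> and \<open>q\<close> stays below \<open>f + e\<close> near \<open>q\<close>; the
  infimum over a finite subcover stays below it everywhere and keeps the value at \<open>p\<close>,
  which all interpolants share.\<close>

lemma character_minorant:
  assumes f: "continuous_on \<Delta> f" and p: "p \<in> \<Delta>" and e: "0 < e"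
  shows "\<exists>x. p x = f p \<and> (\<forall>k\<in>\<Delta>. k x \<le> f k + e)"
proof -
  have "\<exists>x. p x = f p \<and> q x = f q" if "q \<in> \<Delta>" for q
    using characters_separate[OF p that] .
  then obtain X where X: "\<And>q. q \<in> \<Delta> \<Longrightarrow> p (X q) = f p \<and> q (X q) = f q" by metis
  have "continuous_on \<Delta> (\<lambda>k. k (X q) - f k)" for q
    using f by (intro continuous_on_diff continuous_on_characters)
  then have "\<exists>V. open V \<and> V \<inter> \<Delta> = (\<lambda>k. k (X q) - f k) -` {..<e} \<inter> \<Delta>" for q
    unfolding continuous_on_open_invariant by (metis open_lessThan)
  then obtain V where V: "\<And>q. open (V q)" "\<And>q. V q \<inter> \<Delta> = (\<lambda>k. k (X q) - f k) -` {..<e} \<inter> \<Delta>"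
    by metis
  have "\<Delta> \<subseteq> (\<Union>q\<in>\<Delta>. V q)"
  proof
    fix q assume q: "q \<in> \<Delta>"
    with X e have "q \<in> (\<lambda>k. k (X q) - f k) -` {..<e} \<inter> \<Delta>" by simp
    with V(2)[of q] q show "q \<in> (\<Union>q\<in>\<Delta>. V q)" by blast
  qed
  then obtain Q where Q: "Q \<subseteq> \<Delta>" "finite Q" "\<Delta> \<subseteq> (\<Union>q\<in>Q. V q)"
    using compactE_image[OF compact_characters, of \<Delta> V] V(1) by metis
  have "\<exists>y. p y = f p \<and> (\<forall>k\<in>\<Delta>. \<forall>q\<in>Q. k y \<le> k (X q))"
    using Q(2,1)
  proof (induction Q)
    case empty
    show ?case using p by (intro exI[of _ "f p *\<^sub>R u"]) (simp add: character_simps)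
  next
    case (insert q Q)
    then obtain y where "p y = f p" "\<forall>k\<in>\<Delta>. \<forall>q\<in>Q. k y \<le> k (X q)" by blast
    moreover have "p (X q) = f p" using insert X by simp
    ultimately show ?case using p
      by (intro exI[of _ "inf y (X q)"]) (simp add: character_inf min_le_iff_disj)
  qed
  then obtain y where y: "p y = f p" "\<forall>k\<in>\<Delta>. \<forall>q\<in>Q. k y \<le> k (X q)" by blast
  have "k y \<le> f k + e" if k: "k \<in> \<Delta>" for k
  proof -
    obtain q where "q \<in> Q" "k \<in> V q" using Q k by blast
    then have "k (X q) - f k < e" using V(2)[of q] k by blast
    moreover have "k y \<le> k (X q)" using y k \<open>q \<in> Q\<close> by blast
    ultimately show ?thesis by simp
  qed
  with y show ?thesis by blast
qed

text \<open>
  Only one-sided approximation is needed: by Dedekind completeness the supremum of all elements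
  below \<open>f\<close> exists, and minorants of \<open>f\<close> and \<open>- f\<close> pin down its values.
\<close>

lemma character_surj:
  assumes f: "continuous_on \<Delta> f"
  shows "\<exists>x. \<forall>k\<in>\<Delta>. k x = f k"
proof -
  define A where "A = {x. \<forall>k\<in>\<Delta>. k x \<le> f k}"
  have lower: "\<exists>x\<in>A. p x \<ge> f p - e" if p: "p \<in> \<Delta>" and e: "0 < e" for p e
  proof -
    obtain x where x: "p x = f p" "\<forall>k\<in>\<Delta>. k x \<le> f k + e" using character_minorant[OF f p e] by blast
    then show ?thesis using p
      by (intro bexI[of _ "x - e *\<^sub>R u"]) (auto simp: A_def character_simps algebra_simps)
  qed
  \<comment> \<open>A minorant of \<open>- f\<close> with the right value at \<open>p\<close>,
    reflected and raised by \<open>e\<close>, bounds all of \<open>A\<close> from above.\<close>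
  have upper: "\<exists>b. (\<forall>x\<in>A. x \<le> b) \<and> p b \<le> f p + e" if p: "p \<in> \<Delta>" and e: "0 < e" for p e
  proof -
    obtain x where x: "p x = - f p" "\<forall>k\<in>\<Delta>. k x \<le> - f k + e"
      using character_minorant[of "\<lambda>k. - f k", OF _ p e] f by (auto intro: continuous_on_minus)
    have "y \<le> e *\<^sub>R u - x" if "y \<in> A" for y
      unfolding le_iff_characters
    proof
      fix k assume k: "k \<in> \<Delta>"
      with that have "k y \<le> f k" by (simp add: A_def)
      moreover have "k x \<le> - f k + e" using k x by blast
      ultimately show "k y \<le> k (e *\<^sub>R u - x)" using k by (simp add: character_simps)
    qed
    then show ?thesis using p x by (intro exI[of _ "e *\<^sub>R u - x"]) (auto simp: character_simps)
  qed
  show ?thesis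
  \<comment> \<open>Without characters the claim is vacuous; a single character already provides a
    member and an upper bound of \<open>A\<close>.\<close>
  proof (cases "\<Delta> = {}")
    case False
    then have ne: "A \<noteq> {}" and bdd: "bdd_above A"
      using lower[of _ 1] upper[of _ 1] by (auto simp: bdd_above_def)
    have "p (Sup A) = f p" if p: "p \<in> \<Delta>" for p
    proof (rule antisym)
      show "p (Sup A) \<le> f p"
      proof (rule field_le_epsilon)
        fix e :: real assume "0 < e"
        then obtain b where "\<forall>x\<in>A. x \<le> b" "p b \<le> f p + e" using upper[OF p] by blast
        then show "p (Sup A) \<le> f p + e"
          using character_mono[OF p cSup_least[OF ne, of b]] by fastforce
      qed
      show "f p \<le> p (Sup A)"
      proof (rule field_le_epsilon)
        fix e :: real assume "0 < e"
        then obtain x where "x \<in> A" "p x \<ge> f p - e" using lower[OF p] by blast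
        then show "f p \<le> p (Sup A) + e"
          using character_mono[OF p cSup_upper[OF _ bdd, of x]] by fastforce
      qed
    qed
    then show ?thesis by blast
  qed simp
qed

lemma yosida_characters: "yosida_representation u (top_of_set \<Delta>) (\<lambda>x k. k x)"
  unfolding yosida_representation_def
proof (intro conjI allI impI ballI)
  show "compact_space (top_of_set \<Delta>)"
    using compact_characters by (simp add: compact_space_subtopology)
  show "Hausdorff_space (top_of_set \<Delta>)"
    by (intro Hausdorff_space_subtopology)
      (simp add: Hausdorff_space_product_topology flip: euclidean_product_topology)
  show "continuous_map (top_of_set \<Delta>) euclideanreal (\<lambda>k. k x)" for x
    by (simp add: continuous_on_characters)
  show "\<exists>x. \<forall>k\<in>topspace (top_of_set \<Delta>). k x = f k"
    if "continuous_map (top_of_set \<Delta>) euclideanreal f" for f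
    using that character_surj[of f] by auto
qed (auto simp: character_simps intro: eq_characters)

text \<open>Existence of the product comes from surjectivity onto the continuous functions,
  uniqueness from the comparison of representations. Everything later about the multiplication rests
  on this pointwise rule.\<close>

lemma character_f_mult:
  assumes k: "k \<in> \<Delta>"
  shows "k (f_mult u x y) = k x * k y"
proof -
  obtain z where z: "\<forall>k\<in>\<Delta>. k z = k x * k y"
    using character_surj[OF continuous_on_mult[OF continuous_on_characters continuous_on_characters]]
    by blast
  have "f_mult u x y = z"
    unfolding f_mult_def
  proof (rule the_equality)
    show "\<exists>(K :: ('a \<Rightarrow> real) topology) \<phi>. yosida_representation u K \<phi> \<and>
        (\<forall>k\<in>topspace K. \<phi> z k = \<phi> x k * \<phi> y k)"
      using yosida_characters z by (intro exI[of _ "top_of_set \<Delta>"] exI[of _ "\<lambda>x k. k x"]) simp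
  next
    fix z' assume "\<exists>(K :: ('a \<Rightarrow> real) topology) \<phi>. yosida_representation u K \<phi> \<and>
        (\<forall>k\<in>topspace K. \<phi> z' k = \<phi> x k * \<phi> y k)"
    then show "z' = z"
      using yosida_product_unique[OF _ yosida_characters, of _ _ z' x y z] z by auto
  qed
  with z k show ?thesis by blast
qed

end

section \<open>Closed Riesz subspaces, components and bands\<close>

lemma decreases_to_zero_nonneg_le:
  assumes "decreases_to_zero D" "\<And>d. d \<in> D \<Longrightarrow> x \<le> d"
  shows "x \<le> 0"
  using assms cInf_greatest[of D x] unfolding decreases_to_zero_def by metis

lemma closed_riesz_subspace_Inter:
  assumes "\<And>S. S \<in> \<S> \<Longrightarrow> closed_riesz_subspace S"
  shows "closed_riesz_subspace (\<Inter>\<S>)"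
  unfolding closed_riesz_subspace_def riesz_subspace_def
proof (intro conjI)
  show "subspace (\<Inter>\<S>)"
    using assms by (intro subspace_Inter) (auto simp: closed_riesz_subspace_def riesz_subspace_def)
  show "\<forall>x\<in>\<Inter>\<S>. \<forall>y\<in>\<Inter>\<S>. sup x y \<in> \<Inter>\<S> \<and> inf x y \<in> \<Inter>\<S>"
    using assms unfolding closed_riesz_subspace_def riesz_subspace_def by blast
  show "order_closed (\<Inter>\<S>)"
    unfolding order_closed_def
  proof (intro allI impI InterI)
    fix F x S
    assume *: "F \<noteq> bot \<and> eventually (\<lambda>y. y \<in> \<Inter>\<S>) F \<and> order_tendsto (\<lambda>y. y) x F" and S: "S \<in> \<S>"
    then have "eventually (\<lambda>y. y \<in> S) F" by (auto elim!: eventually_mono)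
    with * assms[OF S] show "x \<in> S" unfolding closed_riesz_subspace_def order_closed_def by blast
  qed
qed

lemma closed_riesz_generated_subspace: "closed_riesz_subspace (generated_subspace A)"
  unfolding generated_subspace_def 
  by (rule hull_in) (rule closed_riesz_subspace_Inter, blast)

lemma generated_subspace_superset: "A \<subseteq> generated_subspace A"
  unfolding generated_subspace_def by (rule hull_subset)

text \<open>Closedness is phrased with filters, so the directed set is turned into one:
  \<open>F\<close> is generated by the tails of \<open>A\<close>, and on the tail above
  \<open>a\<close> the distance to the supremum is at most \<open>Sup A - a\<close>.\<close>

lemma order_closed_Sup:
  fixes S :: "'a::dedekind_complete_riesz_space set"
  assumes S: "order_closed S" and A: "A \<subseteq> S" "A \<noteq> {}" and bdd: "bdd_above A"
    and directed: "\<And>x y. x \<in> A \<Longrightarrow> y \<in> A \<Longrightarrow> \<exists>z\<in>A. x \<le> z \<and> y \<le> z"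
  shows "Sup A \<in> S"
proof -
  define F where "F = (INF a\<in>A. principal {x \<in> A. a \<le> x})"
  have ev: "eventually P F \<longleftrightarrow> (\<exists>a\<in>A. \<forall>x\<in>A. a \<le> x \<longrightarrow> P x)" for P
    unfolding F_def
  proof (subst eventually_INF_base)
    show "\<exists>z\<in>A. principal {x \<in> A. z \<le> x} \<le> inf (principal {y \<in> A. a \<le> y}) (principal {x \<in> A. b \<le> x})"
      if "a \<in> A" "b \<in> A" for a b
    proof -
      obtain z where "z \<in> A" "a \<le> z" "b \<le> z" using directed \<open>a \<in> A\<close> \<open>b \<in> A\<close> by blast
      then show ?thesis by (intro bexI[of _ z]) (auto intro: order_trans)
    qed
  qed (use A in \<open>auto simp: eventually_principal\<close>)
  define D where "D = (\<lambda>a. Sup A - a) ` A"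
  have upper: "a \<le> Sup A" if "a \<in> A" for a using that bdd by (rule cSup_upper)
  have D0: "\<forall>d\<in>D. 0 \<le> d" using upper by (auto simp: D_def)
  have "Inf D \<le> 0"
  proof -
    have "Sup A \<le> Sup A - Inf D"
    proof (rule cSup_least)
      fix a assume "a \<in> A"
      then have "Inf D \<le> Sup A - a"
        using D0 by (intro cInf_lower bdd_belowI[of D 0]) (auto simp: D_def)
      then show "a \<le> Sup A - Inf D" by (simp add: algebra_simps)
    qed (use A in auto)
    then show ?thesis by simp
  qed
  moreover have "0 \<le> Inf D" using D0 A by (intro cInf_greatest) (auto simp: D_def)
  moreover have "\<exists>c\<in>D. c \<le> d \<and> c \<le> e" if de: "d \<in> D" "e \<in> D" for d e
  proof -
    obtain x y where xy: "x \<in> A" "y \<in> A" "d = Sup A - x" "e = Sup A - y" using de by (auto simp: D_def)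
    then obtain z where "z \<in> A" "x \<le> z" "y \<le> z" using directed by blast
    with xy show ?thesis by (intro bexI[of _ "Sup A - z"]) (auto simp: D_def)
  qed
  ultimately have D: "decreases_to_zero D"
    using D0 A unfolding decreases_to_zero_def by (auto simp: D_def)
  have "eventually (\<lambda>x. \<bar>x - Sup A\<bar> \<le> d) F" if d: "d \<in> D" for d
  proof -
    obtain a where a: "a \<in> A" "d = Sup A - a" using d unfolding D_def by blast
    have "\<bar>x - Sup A\<bar> \<le> d" if "x \<in> A" "a \<le> x" for x
    proof -
      have "\<bar>x - Sup A\<bar> = Sup A - x" using upper[OF that(1)] by (simp add: abs_minus_commute)
      then show ?thesis using a that by simp
    qed
    with a show ?thesis unfolding ev by blast
  qed
  with D have "order_tendsto (\<lambda>x. x) (Sup A) F" unfolding order_tendsto_def by blast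
  moreover have "F \<noteq> bot" unfolding trivial_limit_def ev using directed by blast
  moreover have "eventually (\<lambda>x. x \<in> S) F" unfolding ev using A by blast
  ultimately show ?thesis using S unfolding order_closed_def by blast
qed

context strong_unit
begin

abbreviation unit_mult (infixl \<open>\<cdot>\<close> 70) where "x \<cdot> y \<equiv> f_mult u x y"

lemma inf_abs_eq_0_iff: "inf \<bar>x\<bar> \<bar>y\<bar> = 0 \<longleftrightarrow> (\<forall>k\<in>\<Delta>. k x = 0 \<or> k y = 0)"
proof
  assume *: "inf \<bar>x\<bar> \<bar>y\<bar> = 0"
  show "\<forall>k\<in>\<Delta>. k x = 0 \<or> k y = 0"
  proof
    fix k assume k: "k \<in> \<Delta>"
    then have "k (inf \<bar>x\<bar> \<bar>y\<bar>) = min \<bar>k x\<bar> \<bar>k y\<bar>" by (simp add: character_simps)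
    with * k show "k x = 0 \<or> k y = 0" by (simp add: character_zero min_def split: if_splits)
  qed
next
  assume *: "\<forall>k\<in>\<Delta>. k x = 0 \<or> k y = 0"
  show "inf \<bar>x\<bar> \<bar>y\<bar> = 0"
  proof (rule eq_characters)
    fix k assume k: "k \<in> \<Delta>"
    with * show "k (inf \<bar>x\<bar> \<bar>y\<bar>) = k 0" by (auto simp: character_simps)
  qed
qed

text \<open>The elements of \<open>F\<close> below \<open>y\<close> are directed under
  \<open>sup\<close>, so their supremum stays in \<open>F\<close>. It lies below \<open>y\<close>
  and, at each character, above an element that already attains the value of
  \<open>y\<close>.\<close>

lemma closed_riesz_subspace_attained:
  assumes F: "closed_riesz_subspace F"
    and below: "\<And>k. k \<in> \<Delta> \<Longrightarrow> \<exists>a\<in>F. a \<le> y \<and> k a = k y"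
  shows "y \<in> F"
proof (cases "\<Delta> = {}")
  case True
  then have "y = 0" by (intro eq_characters) auto
  then show ?thesis using F subspace_0 by (auto simp: closed_riesz_subspace_def riesz_subspace_def)
next
  case False
  define A where "A = {a \<in> F. a \<le> y}"
  have ne: "A \<noteq> {}" using below False by (auto simp: A_def)
  have bdd: "bdd_above A" by (auto simp: A_def intro: bdd_aboveI)
  have "Sup A \<in> F"
  proof (rule order_closed_Sup[OF _ _ ne bdd])
    show "\<exists>z\<in>A. a \<le> z \<and> b \<le> z" if "a \<in> A" "b \<in> A" for a b
      using that F unfolding A_def closed_riesz_subspace_def riesz_subspace_def
      by (intro bexI[of _ "sup a b"]) auto
  qed (use F in \<open>auto simp: A_def closed_riesz_subspace_def\<close>)
  also have "Sup A = y"
  proof (rule eq_characters)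
    fix k assume k: "k \<in> \<Delta>"
    then obtain a where a: "a \<in> F" "a \<le> y" "k a = k y" using below by blast
    then have "a \<le> Sup A" using bdd by (intro cSup_upper) (auto simp: A_def)
    moreover have "Sup A \<le> y" using ne by (intro cSup_least) (auto simp: A_def)
    ultimately show "k (Sup A) = k y" using a k by (metis character_mono order.antisym)
  qed
  finally show ?thesis .
qed

text \<open>\<open>component x\<close> is the image of \<open>u\<close> under the projection onto the band generated by \<open>x\<^sup>+\<close>.\<close>

definition component :: "'a \<Rightarrow> 'a" where
  "component x = Sup (range (\<lambda>n. inf (real n *\<^sub>R pprt x) u))"

lemma component_upper: "inf (real n *\<^sub>R pprt x) u \<le> component x"
  unfolding component_def by (rule cSup_upper) (auto intro!: bdd_aboveI[of _ u])

text \<open>Since evaluation need not commute with the supremum defining the component, its values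
  are controlled by test elements \<open>w\<close>; the lemmas below choose \<open>w\<close> so as
  to force the value at a given character.\<close>

lemma component_least:
  assumes nn: "0 \<le> w" and pos: "\<And>k. k \<in> \<Delta> \<Longrightarrow> 0 < k x \<Longrightarrow> 1 \<le> k w"
  shows "component x \<le> w"
  unfolding component_def
proof (rule cSup_least)
  fix y assume "y \<in> range (\<lambda>n. inf (real n *\<^sub>R pprt x) u)"
  then obtain n where y: "y = inf (real n *\<^sub>R pprt x) u" by blast
  show "y \<le> w"
    unfolding le_iff_characters
  proof
    fix k assume k: "k \<in> \<Delta>"
    have "k y = min (real n * max (k x) 0) 1" using k by (simp add: y character_simps)
    moreover have "0 \<le> k w" using character_mono[OF k nn] k by (simp add: character_simps)
    ultimately show "k y \<le> k w" using pos[OF k] by (cases "0 < k x") (auto simp: max_def min_def)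
  qed
qed simp

lemma component_le_unit: "component x \<le> u"
  using unit_nonneg by (intro component_least) (simp_all add: character_simps)

lemma component_nonneg: "0 \<le> component x"
  using component_upper[of 0 x] unit_nonneg by (simp add: inf_absorb1)

lemma character_component_pos:
  assumes k: "k \<in> \<Delta>" and pos: "0 < k x"
  shows "k (component x) = 1"
proof -
  obtain n where n: "1 \<le> real n * k x" using reals_Archimedean3[OF pos] by (metis less_imp_le)
  have "k (inf (real n *\<^sub>R pprt x) u) = 1" using k pos n by (simp add: character_simps)
  then have "1 \<le> k (component x)" using character_mono[OF k component_upper[of n x]] by simp
  then show ?thesis using character_mono[OF k component_le_unit[of x]] k by (simp add: character_simps)
qed

lemma character_component_neg:
  assumes k: "k \<in> \<Delta>" and neg: "k x < 0"
  shows "k (component x) = 0"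
proof -
  \<comment> \<open>The scaling makes \<open>w\<close> vanish at \<open>k\<close>, while
    \<open>w\<close> has value 1 wherever \<open>x\<close> is positive, because the negative part is
    zero there.\<close>
  define w where "w = u - inf u ((1 / (- k x)) *\<^sub>R pprt (- x))"
  have "component x \<le> w"
  proof (rule component_least)
    show "0 \<le> w" unfolding w_def diff_ge_0_iff_ge by (rule inf.cobounded1)
    fix l assume "l \<in> \<Delta>" "0 < l x"
    then show "1 \<le> l w" by (simp add: w_def character_simps)
  qed
  then have "k (component x) \<le> k w" by (rule character_mono[OF k])
  also have "k w = 0" using k neg by (simp add: w_def character_simps)
  finally have "k (component x) \<le> 0" .
  moreover have "0 \<le> k (component x)"
    using character_mono[OF k component_nonneg] k by (simp add: character_simps)
  ultimately show ?thesis by simp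
qed

text \<open>Characters with \<open>k x = 0\<close> are the delicate ones. Where \<open>x\<close> is
  positive, \<open>p = component x\<close> has value 1 and so has \<open>2 p - u\<close>; hence
  \<open>p\<close> lies below the positive part of \<open>2 p - u\<close>. For a value
  \<open>r\<close> in the unit interval, \<open>r \<le> max 0 (2 r - 1)\<close> leaves only 0 and
  1.\<close>

lemma character_component:
  assumes k: "k \<in> \<Delta>"
  shows "k (component x) = 0 \<or> k (component x) = 1"
proof -
  let ?p = "component x"
  have "?p \<le> sup 0 (2 *\<^sub>R ?p - u)"
  proof (rule component_least)
    fix l assume "l \<in> \<Delta>" "0 < l x"
    then show "1 \<le> l (sup 0 (2 *\<^sub>R ?p - u))" by (simp add: character_component_pos character_simps)
  qed simp
  then have "k ?p \<le> max 0 (2 * k ?p - 1)"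
    using character_mono[OF k, of ?p "sup 0 (2 *\<^sub>R ?p - u)"] k by (simp add: character_simps)
  moreover have "0 \<le> k ?p" "k ?p \<le> 1"
    using character_mono[OF k component_nonneg] character_mono[OF k component_le_unit] k
    by (simp_all add: character_simps)
  ultimately show ?thesis by (auto simp: max_def split: if_splits)
qed

lemma component_in_order_closed:
  assumes "order_closed S" "\<And>n. inf (real n *\<^sub>R pprt x) u \<in> S"
  shows "component x \<in> S"
  unfolding component_def
proof (rule order_closed_Sup[OF assms(1)])
  show "\<exists>z\<in>range (\<lambda>n. inf (real n *\<^sub>R pprt x) u). y \<le> z \<and> y' \<le> z"
    if y: "y \<in> range (\<lambda>n. inf (real n *\<^sub>R pprt x) u)" "y' \<in> range (\<lambda>n. inf (real n *\<^sub>R pprt x) u)" for y y'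
  proof -
    obtain m n where "y = inf (real m *\<^sub>R pprt x) u" "y' = inf (real n *\<^sub>R pprt x) u" using y by blast
    moreover have "inf (real j *\<^sub>R pprt x) u \<le> inf (real (max m n) *\<^sub>R pprt x) u" if "j \<le> max m n" for j
      using that by (intro inf_mono scaleR_right_mono) auto
    ultimately show ?thesis by (intro bexI[of _ "inf (real (max m n) *\<^sub>R pprt x) u"]) auto
  qed
qed (use assms in \<open>auto intro!: bdd_aboveI[of _ u]\<close>)

lemma component_in_subspace:
  assumes F: "closed_riesz_subspace F" and "u \<in> F" "x \<in> F"
  shows "component x \<in> F"
proof (rule component_in_order_closed)
  show "order_closed F" using F by (simp add: closed_riesz_subspace_def)
  have "pprt x \<in> F" using F assms subspace_0
    unfolding pprt_def closed_riesz_subspace_def riesz_subspace_def by blast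
  then show "inf (real n *\<^sub>R pprt x) u \<in> F" for n
    using F assms subspace_scale unfolding closed_riesz_subspace_def riesz_subspace_def by blast
qed

section \<open>Bands cut out by 0/1-valued elements, and their projections\<close>

definition support_band :: "'a \<Rightarrow> 'a set" where
  "support_band p = {x. \<forall>k\<in>\<Delta>. k p = 0 \<longrightarrow> k x = 0}"

lemma band_support_band:
  assumes p: "\<And>k. k \<in> \<Delta> \<Longrightarrow> k p = 0 \<or> k p = 1"
  shows "band (support_band p)"
  unfolding band_def
proof (intro conjI allI impI)
  show "subspace (support_band p)"
    by (rule subspaceI) (auto simp: support_band_def character_simps)
next
  fix x y assume xy: "y \<in> support_band p \<and> \<bar>x\<bar> \<le> \<bar>y\<bar>"
  have "k x = 0" if k: "k \<in> \<Delta>" "k p = 0" for k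
  proof -
    have "\<bar>k x\<bar> \<le> \<bar>k y\<bar>"
      using character_mono[OF k(1), of "\<bar>x\<bar>" "\<bar>y\<bar>"] xy k by (simp add: character_abs)
    moreover have "k y = 0" using xy k by (simp add: support_band_def)
    ultimately show ?thesis by simp
  qed
  then show "x \<in> support_band p" by (simp add: support_band_def)
next
  show "order_closed (support_band p)"
    unfolding order_closed_def
  proof (intro allI impI)
    fix F x assume *: "F \<noteq> bot \<and> eventually (\<lambda>y. y \<in> support_band p) F \<and> order_tendsto (\<lambda>y. y) x F"
    then obtain D where D: "decreases_to_zero D" "\<And>d. d \<in> D \<Longrightarrow> eventually (\<lambda>y. \<bar>y - x\<bar> \<le> d) F"
      unfolding order_tendsto_def by blast
    \<comment> \<open>Multiplication by \<open>u - p\<close> kills the members \<open>y\<close> of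
      the band and does not increase the modulus, so what remains of \<open>x\<close> is dominated
      by \<open>\<bar>y - x\<bar>\<close>.\<close>
    have "\<bar>(u - p) \<cdot> x\<bar> \<le> d" if d: "d \<in> D" for d
    proof -
      have "eventually (\<lambda>y. y \<in> support_band p \<and> \<bar>y - x\<bar> \<le> d) F"
        using * D(2)[OF d] by (auto intro: eventually_conj)
      then obtain y where y: "y \<in> support_band p" "\<bar>y - x\<bar> \<le> d"
        using * eventually_happens' by blast
      show ?thesis
        unfolding le_iff_characters
      proof
        fix k assume k: "k \<in> \<Delta>"
        have "\<bar>k y - k x\<bar> \<le> k d" using character_mono[OF k y(2)] k by (simp add: character_simps)
        then show "k \<bar>(u - p) \<cdot> x\<bar> \<le> k d"
          using p[OF k] y(1) k by (auto simp: support_band_def character_simps character_f_mult)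
      qed
    qed
    then have "\<bar>(u - p) \<cdot> x\<bar> \<le> 0" using D(1) by (rule decreases_to_zero_nonneg_le[rotated])
    then have z: "(u - p) \<cdot> x = 0" by simp
    have "k x = 0" if k: "k \<in> \<Delta>" "k p = 0" for k
      using arg_cong[OF z, of k] k by (simp add: character_simps character_f_mult)
    then show "x \<in> support_band p" by (simp add: support_band_def)
  qed
qed

text \<open>Where \<open>p\<close> is 1, disjointness of \<open>x - y\<close> from \<open>p\<close>
  forces \<open>y\<close> to agree with \<open>x\<close>; where \<open>p\<close> is 0, membership
  forces \<open>y\<close> to vanish. This leaves \<open>p \<cdot> x\<close> as the only solution of
  the description.\<close>

lemma band_proj_support_band:
  assumes p: "\<And>k. k \<in> \<Delta> \<Longrightarrow> k p = 0 \<or> k p = 1"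
  shows "band_proj (support_band p) x = p \<cdot> x"
  unfolding band_proj_def
proof (rule the_equality)
  show "p \<cdot> x \<in> support_band p \<and> (\<forall>b\<in>support_band p. inf \<bar>x - p \<cdot> x\<bar> \<bar>b\<bar> = 0)"
    unfolding inf_abs_eq_0_iff
  proof (intro conjI ballI)
    show "p \<cdot> x \<in> support_band p" by (simp add: support_band_def character_f_mult)
    fix b k assume "b \<in> support_band p" and k: "k \<in> \<Delta>"
    with p[OF k] show "k (x - p \<cdot> x) = 0 \<or> k b = 0"
      by (auto simp: support_band_def character_f_mult character_diff)
  qed
next
  fix y assume y: "y \<in> support_band p \<and> (\<forall>b\<in>support_band p. inf \<bar>x - y\<bar> \<bar>b\<bar> = 0)"
  have ps: "p \<in> support_band p" by (simp add: support_band_def)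
  show "y = p \<cdot> x"
  proof (rule eq_characters)
    fix k assume k: "k \<in> \<Delta>"
    have "k (x - y) = 0 \<or> k p = 0" using y ps k unfolding inf_abs_eq_0_iff by blast
    then show "k y = k (p \<cdot> x)"
      using p[OF k] y k by (auto simp: support_band_def character_f_mult character_simps)
  qed
qed

lemma generated_band_pprt: "generated_band (pprt x) = support_band (component x)"
  unfolding generated_band_def
proof (rule hull_unique)
  show "{pprt x} \<subseteq> support_band (component x)"
  proof -
    have "k (pprt x) = 0" if "k \<in> \<Delta>" "k (component x) = 0" for k
      using character_component_pos[of k x] that by (cases "0 < k x") (auto simp: character_simps)
    then show ?thesis by (simp add: support_band_def)
  qed
  show "band (support_band (component x))" using character_component by (rule band_support_band)
next
  fix B assume B: "{pprt x} \<subseteq> B" "band B"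
  then have sub: "subspace B" and solid: "\<And>v w. w \<in> B \<Longrightarrow> \<bar>v\<bar> \<le> \<bar>w\<bar> \<Longrightarrow> v \<in> B"
    and closed: "order_closed B" unfolding band_def by blast+
  have "inf (real n *\<^sub>R pprt x) u \<in> B" for n
  proof (rule solid)
    show "real n *\<^sub>R pprt x \<in> B" using B sub by (simp add: subspace_scale)
    have "0 \<le> inf (real n *\<^sub>R pprt x) u" using unit_nonneg by (simp add: scaleR_nonneg_nonneg)
    then show "\<bar>inf (real n *\<^sub>R pprt x) u\<bar> \<le> \<bar>real n *\<^sub>R pprt x\<bar>"
      by (simp add: scaleR_nonneg_nonneg)
  qed
  then have comp: "component x \<in> B" by (rule component_in_order_closed[OF closed])
  show "support_band (component x) \<subseteq> B"
  proof
    fix y assume y: "y \<in> support_band (component x)"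
    obtain c where c: "0 < c" "\<bar>y\<bar> \<le> c *\<^sub>R u" using unit_bound .
    \<comment> \<open>\<open>y\<close> vanishes where the component is 0 and is bounded by
      \<open>c\<close> where it is 1; solidity of \<open>B\<close> then gives membership.\<close>
    have "\<bar>y\<bar> \<le> \<bar>c *\<^sub>R component x\<bar>"
      unfolding le_iff_characters
    proof
      fix k assume k: "k \<in> \<Delta>"
      show "k \<bar>y\<bar> \<le> k \<bar>c *\<^sub>R component x\<bar>"
        using character_component[OF k, of x] y k c(1) character_mono[OF k c(2)]
        by (auto simp: support_band_def character_simps)
    qed
    then show "y \<in> B" by (rule solid[rotated]) (rule subspace_scale[OF sub comp])
  qed
qed

lemma band_proj_pprt_unit: "band_proj (generated_band (pprt x)) u = component x"
proof -
  have "band_proj (generated_band (pprt x)) u = component x \<cdot> u"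
    unfolding generated_band_pprt using character_component by (rule band_proj_support_band)
  also have "\<dots> = component x" by (rule eq_characters) (simp add: character_f_mult character_unit)
  finally show ?thesis .
qed

text \<open>
  Binary expansion: an element between \<open>0\<close> and \<open>u\<close> is half the sum of a component and another
  element between \<open>0\<close> and \<open>u\<close>.
\<close>

lemma components_dense:
  assumes F: "closed_riesz_subspace F" and uF: "u \<in> F" and S: "subspace S"
    and comp: "\<And>x. x \<in> F \<Longrightarrow> component x \<in> S"
    and closed: "\<And>x. (\<And>e. 0 < e \<Longrightarrow> \<exists>y\<in>S. \<bar>x - y\<bar> \<le> e *\<^sub>R u) \<Longrightarrow> x \<in> S"
  shows "F \<subseteq> S"
proof -
  have Fs: "subspace F" using F by (simp add: closed_riesz_subspace_def riesz_subspace_def)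
  have binary: "\<exists>g\<in>S. \<bar>x - g\<bar> \<le> (1/2)^n *\<^sub>R u" if "x \<in> F" "0 \<le> x" "x \<le> u" for n x
    using that
  proof (induction n arbitrary: x)
    case 0
    then show ?case using subspace_0[OF S] by (intro bexI[of _ 0]) auto
  next
    case (Suc n)
    define p where "p = component (x - (1/2) *\<^sub>R u)"
    have xF: "x - (1/2) *\<^sub>R u \<in> F" using Suc uF Fs by (intro subspace_diff subspace_scale)
    define x' where "x' = 2 *\<^sub>R x - p"
    \<comment> \<open>At \<open>k x = 1/2\<close> the binary digit \<open>k p\<close> may be either
      0 or 1; both keep the remainder \<open>2 k x - k p\<close> in the unit interval.\<close>
    have k: "0 \<le> k x' \<and> k x' \<le> 1" if k: "k \<in> \<Delta>" for k
    proof -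
      have "0 \<le> k x" "k x \<le> 1"
        using character_mono[OF k Suc.prems(2)] character_mono[OF k Suc.prems(3)] k
        by (simp_all add: character_simps)
      moreover have "k p = 0 \<or> k p = 1" unfolding p_def by (rule character_component[OF k])
      moreover have "k p = 1" if "k x > 1/2"
        unfolding p_def using k that by (intro character_component_pos) (auto simp: character_simps)
      moreover have "k p = 0" if "k x < 1/2"
        unfolding p_def using k that by (intro character_component_neg) (auto simp: character_simps)
      moreover have "k x' = 2 * k x - k p" using k by (simp add: x'_def character_simps)
      ultimately show ?thesis by (cases "k x" "1/2::real" rule: linorder_cases) auto
    qed
    have "0 \<le> x'" "x' \<le> u" using k by (auto simp: le_iff_characters character_simps)
    moreover have "x' \<in> F"
      unfolding x'_def p_def
      using Suc.prems component_in_subspace[OF F uF xF] Fs by (intro subspace_diff subspace_scale)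
    ultimately obtain g where g: "g \<in> S" "\<bar>x' - g\<bar> \<le> (1/2)^n *\<^sub>R u" using Suc.IH by blast
    let ?g = "(1/2) *\<^sub>R (p + g)"
    have "?g \<in> S" using g comp[OF xF] S by (intro subspace_scale subspace_add) (auto simp: p_def)
    moreover have "\<bar>x - ?g\<bar> \<le> (1/2)^Suc n *\<^sub>R u"
      unfolding le_iff_characters
    proof
      fix k assume k: "k \<in> \<Delta>"
      have "\<bar>2 * k x - k p - k g\<bar> \<le> (1/2)^n"
        using character_mono[OF k g(2)] k by (simp add: x'_def character_simps)
      moreover have "2 * k x - k p - k g = 2 * (k x - (k p + k g) / 2)" by (simp add: field_simps)
      ultimately have "2 * \<bar>k x - (k p + k g) / 2\<bar> \<le> (1/2)^n" by (simp only: abs_mult abs_numeral)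
      then show "k \<bar>x - ?g\<bar> \<le> k ((1/2)^Suc n *\<^sub>R u)"
        using k by (simp add: character_simps)
    qed
    ultimately show ?case by blast
  qed
  have unit_interval: "x \<in> S" if x: "x \<in> F" "0 \<le> x" "x \<le> u" for x
  proof (rule closed)
    fix e :: real assume "0 < e"
    then obtain n where n: "(1/2)^n < e" using real_arch_pow_inv[of e "1/2"] by auto
    obtain g where g: "g \<in> S" "\<bar>x - g\<bar> \<le> (1/2)^n *\<^sub>R u" using binary[OF x] by blast
    have "(1/2)^n *\<^sub>R u \<le> e *\<^sub>R u" using n unit_nonneg by (intro scaleR_right_mono) auto
    with g show "\<exists>y\<in>S. \<bar>x - y\<bar> \<le> e *\<^sub>R u" by (meson order_trans)
  qed
  have uS: "u \<in> S" using unit_interval[OF uF] unit_nonneg by simp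
  show ?thesis
  proof
    fix x assume x: "x \<in> F"
    obtain c where c: "0 < c" "\<bar>x\<bar> \<le> c *\<^sub>R u" using unit_bound .
    define y where "y = (1 / (2 * c)) *\<^sub>R (x + c *\<^sub>R u)"
    have y: "0 \<le> k y \<and> k y \<le> 1" if k: "k \<in> \<Delta>" for k
    proof -
      have "\<bar>k x\<bar> \<le> c" using character_mono[OF k c(2)] k by (simp add: character_simps)
      then show ?thesis using c(1) k by (auto simp: y_def character_simps field_simps)
    qed
    have "y \<in> S"
    proof (rule unit_interval)
      show "y \<in> F" unfolding y_def using x uF Fs by (intro subspace_scale subspace_add)
    qed (use y in \<open>auto simp: le_iff_characters character_simps\<close>)
    moreover have "x = (2 * c) *\<^sub>R y - c *\<^sub>R u" using c by (simp add: y_def)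
    ultimately show "x \<in> S" using uS S subspace_diff subspace_scale by metis
  qed
qed

section \<open>The exponential of an element\<close>

lemma exp_exists: "\<exists>y. \<forall>k\<in>\<Delta>. k y = exp (k x)"
  by (intro character_surj continuous_on_exp continuous_on_characters)

definition unit_exp :: "'a \<Rightarrow> 'a" where
  "unit_exp x = (SOME y. \<forall>k\<in>\<Delta>. k y = exp (k x))"

lemma character_unit_exp: "k \<in> \<Delta> \<Longrightarrow> k (unit_exp x) = exp (k x)"
  using someI_ex[OF exp_exists, of x] unfolding unit_exp_def by blast

text \<open>The exponential is the supremum of its tangents.\<close>

lemma unit_exp_in_subspace:
  assumes F: "closed_riesz_subspace F" and uF: "u \<in> F" and xF: "x \<in> F"
  shows "unit_exp x \<in> F"
proof (rule closed_riesz_subspace_attained[OF F])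
  fix k assume k: "k \<in> \<Delta>"
  define c where "c = k x"
  define a where "a = exp c *\<^sub>R (x - c *\<^sub>R u + u)"
  have "a \<in> F"
    unfolding a_def using F uF xF
    by (intro subspace_scale subspace_add subspace_diff)
      (auto simp: closed_riesz_subspace_def riesz_subspace_def)
  moreover have "a \<le> unit_exp x"
    unfolding le_iff_characters
  proof
    fix l assume l: "l \<in> \<Delta>"
    have "exp c * (1 + (l x - c)) \<le> exp c * exp (l x - c)"
      by (intro mult_left_mono exp_ge_add_one_self) auto
    also have "\<dots> = exp (l x)" by (simp flip: exp_add)
    finally show "l a \<le> l (unit_exp x)"
      using l by (simp add: a_def character_simps character_unit_exp algebra_simps)
  qed
  moreover have "k a = k (unit_exp x)" using k by (simp add: a_def c_def character_simps character_unit_exp)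
  ultimately show "\<exists>a\<in>F. a \<le> unit_exp x \<and> k a = k (unit_exp x)" by blast
qed

end

section \<open>Conditional expectations\<close>

lemma exp_le_chord:
  fixes a b l x :: real
  assumes "a < b" "a \<le> x" "x \<le> b"
  shows "exp (l * x) \<le> (b - x) / (b - a) * exp (l * a) + (x - a) / (b - a) * exp (l * b)"
proof -
  define p where "p = (x - a) / (b - a)"
  have p: "0 \<le> p" "p \<le> 1" using assms by (auto simp: p_def)
  have q: "(b - x) / (b - a) = 1 - p" using assms by (simp add: p_def field_simps)
  have "(1 - p) *\<^sub>R (l * a) + p *\<^sub>R (l * b) = l * (a + p * (b - a))" by (simp add: algebra_simps)
  also have "a + p * (b - a) = x" using assms by (simp add: p_def)
  finally have "(1 - p) *\<^sub>R (l * a) + p *\<^sub>R (l * b) = l * x" .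
  moreover have "exp ((1 - p) *\<^sub>R (l * a) + p *\<^sub>R (l * b)) \<le> (1 - p) * exp (l * a) + p * exp (l * b)"
    using p by (intro convex_onD[OF exp_convex]) auto
  ultimately show ?thesis unfolding q by (simp add: p_def)
qed

text \<open>The left side is the chord of \<open>exp (l x)\<close> over \<open>[a, b]\<close>,
  evaluated at \<open>m\<close>. With \<open>p = (m - a) / (b - a)\<close> and
  \<open>h = l (b - a)\<close> it equals \<open>exp (l a) (1 + p (exp h - 1))\<close>, and the
  logarithm of the second factor is at most \<open>h p + h^2 / 8\<close>; this is where the 8 comes
  from.\<close>

lemma chord_le_exp_square:
  fixes a b l m :: real
  assumes ab: "a < b" "a \<le> m" "m \<le> b" and l: "0 \<le> l"
  shows "(b - m) / (b - a) * exp (l * a) + (m - a) / (b - a) * exp (l * b)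
    \<le> exp (l * m) * exp (l\<^sup>2 * (b - a)\<^sup>2 / 8)"
proof -
  define p where "p = (m - a) / (b - a)"
  define h where "h = l * (b - a)"
  have p: "0 \<le> p" and h: "0 \<le> h" using assms by (auto simp: p_def h_def)
  have q: "(b - m) / (b - a) = 1 - p" using ab by (simp add: p_def field_simps)
  have pos: "0 < 1 + p * (exp h - 1)" using p h by (intro add_pos_nonneg mult_nonneg_nonneg) auto
  have "l * b = l * a + h" by (simp add: h_def algebra_simps)
  then have lb: "exp (l * b) = exp (l * a) * exp h" by (simp add: exp_add)
  have hp: "h * p = l * (m - a)" using ab by (simp add: h_def p_def)
  have "(1 - p) * exp (l * a) + p * exp (l * b) = exp (l * a) * (1 + p * (exp h - 1))"
    unfolding lb by (simp add: algebra_simps)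
  also have "\<dots> = exp (l * a + ln (1 + p * (exp h - 1)))" using pos by (simp add: exp_add)
  also have "\<dots> \<le> exp (l * a + h * p + h\<^sup>2 / 8)"
    using Hoeffdings_lemma_aux[OF h p] by simp
  also have "l * a + h * p + h\<^sup>2 / 8 = l * m + l\<^sup>2 * (b - a)\<^sup>2 / 8"
    unfolding hp unfolding h_def power_mult_distrib by (simp add: right_diff_distrib[of l m a])
  finally show ?thesis unfolding q by (simp add: p_def exp_add)
qed

lemma order_tendsto_unique:
  fixes x y :: "'a::dedekind_complete_riesz_space"
  assumes "F \<noteq> bot" "order_tendsto f x F" "order_tendsto f y F"
  shows "x = y"
proof -
  obtain D D' where D: "decreases_to_zero D" "\<And>d. d \<in> D \<Longrightarrow> eventually (\<lambda>i. \<bar>f i - x\<bar> \<le> d) F"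
    and D': "decreases_to_zero D'" "\<And>d. d \<in> D' \<Longrightarrow> eventually (\<lambda>i. \<bar>f i - y\<bar> \<le> d) F"
    using assms unfolding order_tendsto_def by blast
  have le: "\<bar>x - y\<bar> - d' \<le> d" if d: "d \<in> D" "d' \<in> D'" for d d'
  proof -
    have "eventually (\<lambda>i. \<bar>f i - x\<bar> \<le> d \<and> \<bar>f i - y\<bar> \<le> d') F"
      using D(2) D'(2) d by (intro eventually_conj)
    then obtain i where i: "\<bar>f i - x\<bar> \<le> d" "\<bar>f i - y\<bar> \<le> d'"
      using eventually_happens'[OF assms(1)] by blast
    have "\<bar>x - y\<bar> = \<bar>(f i - y) - (f i - x)\<bar>" by simp
    also have "\<dots> \<le> \<bar>f i - y\<bar> + \<bar>f i - x\<bar>" by (rule abs_triangle_ineq4)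
    also have "\<dots> \<le> d' + d" using i by (intro add_mono)
    finally show ?thesis by (simp add: diff_le_eq add.commute)
  qed
  have "\<bar>x - y\<bar> \<le> d'" if "d' \<in> D'" for d'
    using decreases_to_zero_nonneg_le[OF D(1) le[OF _ that]] by simp
  then have "\<bar>x - y\<bar> \<le> 0" by (rule decreases_to_zero_nonneg_le[OF D'(1)])
  then show ?thesis by simp
qed

section \<open>Conditional expectations: averaging, independence, exponential moments\<close>

locale unit_conditional_expectation = strong_unit +
  fixes T :: "'a \<Rightarrow> 'a"
  assumes cond_exp: "conditional_expectation T" and T_unit: "T u = u"
begin

lemma T_add: "T (x + y) = T x + T y"
  and T_diff: "T (x - y) = T x - T y"
  and T_scale: "T (c *\<^sub>R x) = c *\<^sub>R T x"
  and T_zero: "T 0 = 0"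
  using cond_exp unfolding conditional_expectation_def
  by (auto simp: linear_add linear_diff linear_cmul linear_0)

lemma T_idem: "T (T x) = T x"
  using cond_exp unfolding conditional_expectation_def by auto

lemma T_mono: "x \<le> y \<Longrightarrow> T x \<le> T y"
proof -
  assume "x \<le> y"
  then have "0 \<le> T (y - x)" using cond_exp unfolding conditional_expectation_def by simp
  then show ?thesis by (simp add: T_diff)
qed

lemma T_abs: "\<bar>T x\<bar> \<le> T \<bar>x\<bar>"
proof -
  have "T (- x) \<le> T \<bar>x\<bar>" "T x \<le> T \<bar>x\<bar>" 
    by (intro T_mono abs_ge_minus_self abs_ge_self)+
  moreover have "T (- x) = - T x" using T_scale[of "-1" x] by simp
  ultimately show ?thesis by (simp add: abs_le_iff)
qed

text \<open>The definition grants completeness of the range only within itself; closedness in the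
  whole space comes from order continuity. Along a filter on the range \<open>T\<close> is
  eventually the identity, so \<open>x\<close> and \<open>T x\<close> are limits of the same
  net.\<close>

lemma closed_riesz_range: "closed_riesz_subspace (range T)"
  unfolding closed_riesz_subspace_def order_closed_def
proof (intro conjI allI impI)
  show "riesz_subspace (range T)" using cond_exp unfolding conditional_expectation_def by blast
  fix F x assume *: "F \<noteq> bot \<and> eventually (\<lambda>y. y \<in> range T) F \<and> order_tendsto (\<lambda>y. y) x F"
  then have "order_tendsto T (T x) F"
    using cond_exp unfolding conditional_expectation_def order_continuous_def by blast
  then obtain D where D: "decreases_to_zero D" "\<And>d. d \<in> D \<Longrightarrow> eventually (\<lambda>y. \<bar>T y - T x\<bar> \<le> d) F"
    unfolding order_tendsto_def by blast
  have "eventually (\<lambda>y. \<bar>y - T x\<bar> \<le> d) F" if "d \<in> D" for d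
  proof -
    have "eventually (\<lambda>y. y \<in> range T \<and> \<bar>T y - T x\<bar> \<le> d) F"
      using * D(2)[OF that] by (intro eventually_conj) auto
    then show ?thesis by (rule eventually_mono) (auto simp: T_idem)
  qed
  with D(1) have "order_tendsto (\<lambda>y. y) (T x) F" unfolding order_tendsto_def by blast
  then have "x = T x" using * order_tendsto_unique by blast
  then show "x \<in> range T" by blast
qed

lemma T_range: "x \<in> range T \<Longrightarrow> T x = x"
  by (auto simp: T_idem)

lemma unit_in_range: "u \<in> range T"
  using T_unit by (metis rangeI)

lemma mult_commute: "x \<cdot> y = y \<cdot> x"
  by (rule eq_characters) (simp add: character_f_mult)

lemma abs_mult_le:
  assumes "\<bar>x\<bar> \<le> c *\<^sub>R u" "\<bar>y\<bar> \<le> d *\<^sub>R u"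
  shows "\<bar>x \<cdot> y\<bar> \<le> (c * d) *\<^sub>R u"
  unfolding le_iff_characters
proof
  fix k assume k: "k \<in> \<Delta>"
  have "\<bar>k x\<bar> \<le> c" "\<bar>k y\<bar> \<le> d"
    using character_mono[OF k assms(1)] character_mono[OF k assms(2)] k by (simp_all add: character_simps)
  then have "\<bar>k x\<bar> * \<bar>k y\<bar> \<le> c * d" by (intro mult_mono) auto
  then show "k \<bar>x \<cdot> y\<bar> \<le> k ((c * d) *\<^sub>R u)"
    using k by (simp add: character_simps character_f_mult abs_mult)
qed

lemma T_abs_le: "\<bar>x\<bar> \<le> c *\<^sub>R u \<Longrightarrow> \<bar>T x\<bar> \<le> c *\<^sub>R u"
  using T_abs[of x] T_mono[of "\<bar>x\<bar>" "c *\<^sub>R u"] by (simp add: T_scale T_unit)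

lemma mult_diff: "x \<cdot> (y - z) = x \<cdot> y - x \<cdot> z"
  by (rule eq_characters) (simp add: character_f_mult character_simps algebra_simps)

text \<open>The \<open>y\<close> satisfying the identity form a subspace, uniformly closed because
  both sides are Lipschitz in \<open>y\<close> with a constant bounding \<open>x\<close>. Density of
  components does the rest. Averaging uses this once, independence once per factor.\<close>

lemma T_mult_extend:
  assumes F: "closed_riesz_subspace F" "u \<in> F"
    and comp: "\<And>y. y \<in> F \<Longrightarrow> T (x \<cdot> component y) = T x \<cdot> T (component y)"
    and y: "y \<in> F"
  shows "T (x \<cdot> y) = T x \<cdot> T y"
proof -
  define S where "S = {y. T (x \<cdot> y) = T x \<cdot> T y}"
  have "F \<subseteq> S"
  proof (rule components_dense[OF F])
    have "x \<cdot> 0 = 0" "T x \<cdot> 0 = 0"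
      by (rule eq_characters; simp add: character_f_mult character_simps)+
    moreover have "z \<cdot> (y + y') = z \<cdot> y + z \<cdot> y'" for z y y'
      by (rule eq_characters) (simp add: character_f_mult character_simps algebra_simps)
    moreover have "z \<cdot> (c *\<^sub>R y) = c *\<^sub>R (z \<cdot> y)" for z c y
      by (rule eq_characters) (simp add: character_f_mult character_simps)
    ultimately show "subspace S"
      by (intro subspaceI) (simp_all add: S_def T_zero T_add T_scale)
    show "component y \<in> S" if "y \<in> F" for y using comp[OF that] by (simp add: S_def)
    fix y assume approx: "\<And>e. 0 < e \<Longrightarrow> \<exists>z\<in>S. \<bar>y - z\<bar> \<le> e *\<^sub>R u"
    obtain c where c: "0 < c" "\<bar>x\<bar> \<le> c *\<^sub>R u" using unit_bound .
    have "\<bar>T (x \<cdot> y) - T x \<cdot> T y\<bar> \<le> e *\<^sub>R ((2 * c) *\<^sub>R u)" if e: "0 < e" for e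
    proof -
      obtain z where z: "z \<in> S" "\<bar>y - z\<bar> \<le> e *\<^sub>R u" using approx[OF e] by blast
      have "T (x \<cdot> y) - T x \<cdot> T y = T (x \<cdot> (y - z)) - T x \<cdot> T (y - z)"
        using z(1) by (simp add: S_def mult_diff T_diff)
      also have "\<bar>\<dots>\<bar> \<le> \<bar>T (x \<cdot> (y - z))\<bar> + \<bar>T x \<cdot> T (y - z)\<bar>" by (rule abs_triangle_ineq4)
      also have "\<dots> \<le> (c * e) *\<^sub>R u + (c * e) *\<^sub>R u"
        using c z by (intro add_mono T_abs_le abs_mult_le)
      also have "\<dots> = e *\<^sub>R ((2 * c) *\<^sub>R u)" by (simp flip: scaleR_add_left add: mult.commute)
      finally show ?thesis .
    qed
    then have "\<bar>T (x \<cdot> y) - T x \<cdot> T y\<bar> \<le> 0" by (rule archimedean_le_zero)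
    then show "y \<in> S" by (simp add: S_def)
  qed
  with y show ?thesis by (auto simp: S_def)
qed

text \<open>
  For a component \<open>p\<close> in the range, \<open>T (p y)\<close> is dominated by a multiple of \<open>T p = p\<close>, hence vanishes
  off the support of \<open>p\<close>; the same holds for the complement \<open>u - p\<close>.
\<close>

lemma T_averaging:
  assumes x: "x \<in> range T"
  shows "T (y \<cdot> x) = T y \<cdot> x"
proof -
  have vanish: "k (T (p \<cdot> y)) = 0"
    if p: "T p = p" "0 \<le> p" and k: "k \<in> \<Delta>" "k p = 0" for p k
  proof -
    obtain c where c: "0 < c" "\<bar>y\<bar> \<le> c *\<^sub>R u" using unit_bound .
    have "\<bar>p \<cdot> y\<bar> \<le> c *\<^sub>R p"
      unfolding le_iff_characters
    proof
      fix l assume l: "l \<in> \<Delta>"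
      have "\<bar>l y\<bar> \<le> c" "0 \<le> l p"
        using character_mono[OF l c(2)] character_mono[OF l p(2)] l by (simp_all add: character_simps)
      then show "l \<bar>p \<cdot> y\<bar> \<le> l (c *\<^sub>R p)"
        using l mult_right_mono[of "\<bar>l y\<bar>" c "l p"]
        by (simp add: character_simps character_f_mult abs_mult mult.commute)
    qed
    then have "\<bar>T (p \<cdot> y)\<bar> \<le> c *\<^sub>R p"
      using T_abs[of "p \<cdot> y"] T_mono[of "\<bar>p \<cdot> y\<bar>" "c *\<^sub>R p"] p by (simp add: T_scale)
    from character_mono[OF k(1) this] k show ?thesis by (simp add: character_simps)
  qed
  have "T (y \<cdot> x) = T y \<cdot> T x"
  proof (rule T_mult_extend[OF closed_riesz_range unit_in_range _ x])
    fix z assume z: "z \<in> range T"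
    define p where "p = component z"
    have p: "T p = p"
      unfolding p_def by (intro T_range component_in_subspace closed_riesz_range unit_in_range z)
    show "T (y \<cdot> component z) = T y \<cdot> T (component z)"
      unfolding p_def[symmetric] p
    proof (rule eq_characters)
      fix k assume k: "k \<in> \<Delta>"
      have split: "k (T y) = k (T (p \<cdot> y)) + k (T ((u - p) \<cdot> y))"
      proof -
        have "y = p \<cdot> y + (u - p) \<cdot> y"
          by (rule eq_characters) (simp add: character_f_mult character_simps algebra_simps)
        then have "T y = T (p \<cdot> y) + T ((u - p) \<cdot> y)" by (metis T_add)
        then show ?thesis using k by (simp add: character_add)
      qed
      have "k p = 0 \<or> k p = 1" unfolding p_def by (rule character_component[OF k])
      then have "k (T (p \<cdot> y)) = k (T y) * k p"
      proof
        assume kp: "k p = 0"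
        have "k (T (p \<cdot> y)) = 0"
          using vanish[OF p _ k kp] component_nonneg unfolding p_def by blast
        with kp show ?thesis by simp
      next
        assume kp: "k p = 1"
        have "T (u - p) = u - p" by (simp only: T_diff T_unit p)
        from vanish[OF this _ k] have "k (T ((u - p) \<cdot> y)) = 0" if "0 \<le> u - p" "k (u - p) = 0"
          using that .
        moreover have "0 \<le> u - p" unfolding p_def using component_le_unit by simp
        moreover have "k (u - p) = 0" using k kp by (simp add: character_diff character_unit)
        ultimately have "k (T ((u - p) \<cdot> y)) = 0" by blast
        with split kp show ?thesis by simp
      qed
      then show "k (T (y \<cdot> p)) = k (T y \<cdot> p)"
        unfolding mult_commute[of y] character_f_mult[OF k] .
    qed
  qed
  then show ?thesis by (simp only: T_range[OF x])
qed

text \<open>The two factors are extended in turn: the inner pass keeps a component of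
  \<open>y\<close> fixed and frees \<open>x\<close>, the outer pass frees \<open>y\<close>. For two
  components the claim is the hypothesis, applied to the projections onto their support
  bands.\<close>

lemma T_mult_independent:
  assumes indep: "cond_indep_subspaces u T E F"
    and E: "closed_riesz_subspace E" "u \<in> E" and F: "closed_riesz_subspace F" "u \<in> F"
    and x: "x \<in> E" and y: "y \<in> F"
  shows "T (x \<cdot> y) = T x \<cdot> T y"
proof (rule T_mult_extend[OF F _ y])
  fix y assume y: "y \<in> F"
  let ?q = "component y"
  have "T (?q \<cdot> x) = T ?q \<cdot> T x"
  proof (rule T_mult_extend[OF E _ x])
    fix x assume x: "x \<in> E"
    let ?p = "component x"
    let ?P = "band_proj (support_band ?p)" and ?Q = "band_proj (support_band ?q)"
    have proj: "band_proj (support_band (component z)) w = component z \<cdot> w" for z w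
      using character_component by (rule band_proj_support_band)
    have unit: "component z \<cdot> u = component z" for z
      by (rule eq_characters) (simp add: character_f_mult character_unit)
    have "band_projection ?P" "band_projection ?Q"
      unfolding band_projection_def using band_support_band character_component by blast+
    moreover have "?P u \<in> E" "?Q u \<in> F"
      unfolding proj unit using component_in_subspace E F x y by auto
    ultimately have "T (?P (?Q u)) = T (?P u) \<cdot> T (?Q u)"
      using indep unfolding cond_indep_subspaces_def cond_indep_projections_def by blast
    then show "T (?q \<cdot> ?p) = T ?q \<cdot> T ?p"
      unfolding proj unit by (simp add: mult_commute)
  qed
  then show "T (x \<cdot> ?q) = T x \<cdot> T ?q" by (simp add: mult_commute)
qed

text \<open>\<open>T X\<close> is not a scalar, so the factor \<open>g\<close>, the exponential of
  \<open>- l T X\<close>, is taken out of \<open>T\<close> by averaging. The chord is affine and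
  \<open>T u = u\<close>, hence \<open>T\<close> turns the chord at \<open>X\<close> into the chord
  at \<open>T X\<close>; the scalar bound then applies at each character with
  \<open>m = k (T X)\<close>, and \<open>g\<close> cancels the factor
  \<open>exp (l m)\<close>.\<close>

lemma exp_minus_T_bound:
  assumes ab: "a < b" and l: "0 \<le> l" and X: "a *\<^sub>R u \<le> X" "X \<le> b *\<^sub>R u"
  shows "T (unit_exp (l *\<^sub>R (X - T X))) \<le> exp (l\<^sup>2 * (b - a)\<^sup>2 / 8) *\<^sub>R u"
proof -
  define g where "g = unit_exp (- l *\<^sub>R T X)"
  have g: "g \<in> range T"
    unfolding g_def
    by (intro unit_exp_in_subspace closed_riesz_range unit_in_range)
      (simp add: T_scale[symmetric] del: scaleR_minus_left)
  define chord where "chord Z = (exp (l * a) / (b - a)) *\<^sub>R (b *\<^sub>R u - Z) + (exp (l * b) / (b - a)) *\<^sub>R (Z - a *\<^sub>R u)" for Z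
  have chord: "k (chord Z) = (b - k Z) / (b - a) * exp (l * a) + (k Z - a) / (b - a) * exp (l * b)"
    if "k \<in> \<Delta>" for k Z using that by (simp add: chord_def character_simps mult.commute)
  have TX: "a *\<^sub>R u \<le> T X" "T X \<le> b *\<^sub>R u"
    using T_mono[OF X(1)] T_mono[OF X(2)] by (simp_all add: T_scale T_unit)
  have "unit_exp (l *\<^sub>R (X - T X)) \<le> chord X \<cdot> g"
    unfolding le_iff_characters
  proof
    fix k assume k: "k \<in> \<Delta>"
    have "a \<le> k X" "k X \<le> b"
      using character_mono[OF k X(1)] character_mono[OF k X(2)] k by (simp_all add: character_simps)
    then have "exp (l * k X) \<le> k (chord X)" using exp_le_chord[OF ab] k by (simp add: chord)
    then have "exp (l * k X) * exp (- l * k (T X)) \<le> k (chord X) * exp (- l * k (T X))"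
      by (intro mult_right_mono) auto
    moreover have "exp (l * k X) * exp (- l * k (T X)) = exp (l * (k X - k (T X)))"
      by (simp flip: exp_add add: algebra_simps)
    ultimately have "exp (l * (k X - k (T X))) \<le> k (chord X) * exp (- l * k (T X))" by (simp only:)
    then show "k (unit_exp (l *\<^sub>R (X - T X))) \<le> k (chord X \<cdot> g)"
      using k by (simp add: g_def character_simps character_unit_exp character_f_mult)
  qed
  then have "T (unit_exp (l *\<^sub>R (X - T X))) \<le> T (chord X \<cdot> g)" by (rule T_mono)
  also have "\<dots> = T (chord X) \<cdot> g" by (rule T_averaging[OF g])
  also have "T (chord X) = chord (T X)" by (simp add: chord_def T_add T_scale T_diff T_unit)
  also have "chord (T X) \<cdot> g \<le> exp (l\<^sup>2 * (b - a)\<^sup>2 / 8) *\<^sub>R u"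
    unfolding le_iff_characters
  proof
    fix k assume k: "k \<in> \<Delta>"
    have "a \<le> k (T X)" "k (T X) \<le> b"
      using character_mono[OF k TX(1)] character_mono[OF k TX(2)] k by (simp_all add: character_simps)
    then have "k (chord (T X)) \<le> exp (l * k (T X)) * exp (l\<^sup>2 * (b - a)\<^sup>2 / 8)"
      using chord_le_exp_square[OF ab _ _ l] k by (simp add: chord)
    then have "k (chord (T X)) * exp (- l * k (T X))
      \<le> exp (l * k (T X)) * exp (l\<^sup>2 * (b - a)\<^sup>2 / 8) * exp (- l * k (T X))"
      by (intro mult_right_mono) auto
    also have "\<dots> = exp (l\<^sup>2 * (b - a)\<^sup>2 / 8)" by (simp flip: exp_add)
    finally show "k (chord (T X) \<cdot> g) \<le> k (exp (l\<^sup>2 * (b - a)\<^sup>2 / 8) *\<^sub>R u)"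
      using k by (simp add: g_def character_simps character_unit_exp character_f_mult)
  qed
  finally show ?thesis .
qed

text \<open>Independence concerns pairs of disjoint index sets, so the terms up to \<open>j\<close>
  are separated from the next one. Both exponentials lie in the respective generated subspaces,
  which contain each \<open>X i\<close> involved together with \<open>T (X i)\<close>.\<close>

lemma T_unit_exp_sum_bound:
  fixes X :: "nat \<Rightarrow> 'a" and a b :: "nat \<Rightarrow> real"
  assumes indep: "cond_indep_elements u T {1..n} X"
    and X: "\<And>i. i \<in> {1..n} \<Longrightarrow> a i *\<^sub>R u \<le> X i \<and> X i \<le> b i *\<^sub>R u"
    and ab: "\<And>i. i \<in> {1..n} \<Longrightarrow> a i < b i" and l: "0 \<le> l" and jn: "j \<le> n"
  shows "T (unit_exp (l *\<^sub>R (\<Sum>i = 1..j. X i - T (X i))))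
    \<le> exp (l\<^sup>2 * (\<Sum>i = 1..j. (b i - a i)\<^sup>2) / 8) *\<^sub>R u"
  using jn
proof (induction j)
  case 0
  have "unit_exp 0 = u" by (rule eq_characters) (simp add: character_unit_exp character_simps)
  then show ?case by (simp add: T_unit)
next
  case (Suc j)
  define Y where "Y i = X i - T (X i)" for i
  have step: "T (unit_exp (l *\<^sub>R Y (Suc j))) \<le> exp (l\<^sup>2 * (b (Suc j) - a (Suc j))\<^sup>2 / 8) *\<^sub>R u"
    unfolding Y_def using Suc.prems X ab l by (intro exp_minus_T_bound) auto
  show ?case
  \<comment> \<open>The subspace generated by the empty family need not contain \<open>u\<close>,
    which the product rule requires; the first term is covered by the bound for a single
    element.\<close>
  proof (cases "j = 0")
    case True
    with step show ?thesis by (simp add: Y_def)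
  next
    case False
    define E where "E i = generated_subspace ({X i} \<union> range T)" for i
    define G where "G \<Lambda> = generated_subspace (\<Union>i\<in>\<Lambda>. E i)" for \<Lambda>
    have G: "closed_riesz_subspace (G \<Lambda>)" for \<Lambda>
      unfolding G_def by (rule closed_riesz_generated_subspace)
    then have sub: "subspace (G \<Lambda>)" for \<Lambda> by (simp add: closed_riesz_subspace_def riesz_subspace_def)
    have "{X i} \<union> range T \<subseteq> G \<Lambda>" if "i \<in> \<Lambda>" for i \<Lambda>
      using that generated_subspace_superset[of "{X i} \<union> range T"]
        generated_subspace_superset[of "\<Union>i\<in>\<Lambda>. E i"] unfolding E_def[symmetric] G_def by blast
    then have XG: "X i \<in> G \<Lambda>" and TG: "range T \<subseteq> G \<Lambda>" if "i \<in> \<Lambda>" for i \<Lambda> using that by blast+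
    have YG: "Y i \<in> G \<Lambda>" if "i \<in> \<Lambda>" for i \<Lambda>
      unfolding Y_def using XG[OF that] TG[OF that] sub by (intro subspace_diff) auto
    have uG: "u \<in> G \<Lambda>" if "\<Lambda> \<noteq> {}" for \<Lambda> using that TG unit_in_range by blast
    let ?S = "l *\<^sub>R (\<Sum>i = 1..j. Y i)" and ?Z = "l *\<^sub>R Y (Suc j)"
    have "cond_indep_subspaces u T (G {1..j}) (G {Suc j})"
    proof -
      have "{1..j} \<subseteq> {1..n}" "{Suc j} \<subseteq> {1..n}" "{1..j} \<inter> {Suc j} = {}" using Suc.prems by auto
      with indep show ?thesis
        unfolding cond_indep_elements_def cond_indep_family_def E_def[symmetric] G_def by blast
    qed
    moreover have "unit_exp ?S \<in> G {1..j}"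
      using False YG G uG sub
      by (intro unit_exp_in_subspace subspace_scale subspace_sum) auto
    moreover have "unit_exp ?Z \<in> G {Suc j}"
      using YG G uG sub by (intro unit_exp_in_subspace subspace_scale) auto
    ultimately have mult: "T (unit_exp ?S \<cdot> unit_exp ?Z) = T (unit_exp ?S) \<cdot> T (unit_exp ?Z)"
      using False G uG by (intro T_mult_independent[of "G {1..j}" "G {Suc j}"]) auto
    \<comment> \<open>The product estimate is phrased for moduli; positivity of exponentials turns
      upper bounds into such bounds.\<close>
    have bound: "\<bar>T (unit_exp v)\<bar> \<le> c *\<^sub>R u" if "T (unit_exp v) \<le> c *\<^sub>R u" for v c
    proof -
      have "0 \<le> unit_exp v" unfolding le_iff_characters by (simp add: character_unit_exp character_zero)
      then have "0 \<le> T (unit_exp v)" using T_mono[of 0] by (simp add: T_zero)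
      with that show ?thesis by simp
    qed
    have "unit_exp (l *\<^sub>R (\<Sum>i = 1..Suc j. Y i)) = unit_exp ?S \<cdot> unit_exp ?Z"
      by (rule eq_characters)
        (simp add: character_unit_exp character_simps character_f_mult distrib_left exp_add)
    then have "T (unit_exp (l *\<^sub>R (\<Sum>i = 1..Suc j. Y i))) \<le> \<bar>T (unit_exp ?S) \<cdot> T (unit_exp ?Z)\<bar>"
      using mult by (simp only: abs_ge_self)
    also have "\<dots> \<le> (exp (l\<^sup>2 * (\<Sum>i = 1..j. (b i - a i)\<^sup>2) / 8)
        * exp (l\<^sup>2 * (b (Suc j) - a (Suc j))\<^sup>2 / 8)) *\<^sub>R u"
      using Suc step by (intro abs_mult_le bound) (simp_all add: Y_def)
    also have "\<dots> = exp (l\<^sup>2 * (\<Sum>i = 1..Suc j. (b i - a i)\<^sup>2) / 8) *\<^sub>R u"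
      by (simp add: distrib_left add_divide_distrib exp_add)
    finally show ?thesis by (simp add: Y_def)
  qed
qed

text \<open>Chernoff's pointwise bound: where \<open>z\<close> exceeds \<open>t\<close> the right
  side is \<open>exp (l (k z - t))\<close>, at least 1, and elsewhere it only has to be
  nonnegative.\<close>

lemma component_le_exp:
  assumes "0 \<le> l"
  shows "component (z - t *\<^sub>R u) \<le> exp (- (l * t)) *\<^sub>R unit_exp (l *\<^sub>R z)"
proof (rule component_least)
  show "0 \<le> exp (- (l * t)) *\<^sub>R unit_exp (l *\<^sub>R z)"
    by (simp add: le_iff_characters character_simps character_unit_exp)
  fix k assume k: "k \<in> \<Delta>" and pos: "0 < k (z - t *\<^sub>R u)"
  then have "l * t \<le> l * k z" using assms by (intro mult_left_mono) (auto simp: character_simps)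
  then have "1 \<le> exp (- (l * t) + l * k z)" by simp
  also have "\<dots> = exp (- (l * t)) * exp (l * k z)" by (rule exp_add)
  finally show "1 \<le> k (exp (- (l * t)) *\<^sub>R unit_exp (l *\<^sub>R z))"
    using k by (simp add: character_simps character_unit_exp)
qed

end

theorem corollary7p5:
  fixes u :: "'a::dedekind_complete_riesz_space"
    and T :: "'a \<Rightarrow> 'a"
    and X :: "nat \<Rightarrow> 'a"
    and a b :: "nat \<Rightarrow> real"
    and n :: nat
    and t :: real
  assumes "strong_order_unit u"
    and "conditional_expectation T"
    and "strictly_positive T"
    and "T u = u"
    and "1 \<le> n"
    and "cond_indep_elements u T {1..n} X"
    and "\<And>i. i \<in> {1..n} \<Longrightarrow> X i \<in> {a i *\<^sub>R u .. b i *\<^sub>R u}"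
    and "\<And>i. i \<in> {1..n} \<Longrightarrow> a i \<noteq> b i"
    and "0 < t"
  shows "T (band_proj (generated_band (pprt ((\<Sum>i = 1..n. X i - T (X i)) - t *\<^sub>R u))) u)
           \<le> exp (- (2 * t\<^sup>2 / (\<Sum>i = 1..n. (b i - a i)\<^sup>2))) *\<^sub>R u"
proof -
  interpret unit_conditional_expectation u T by unfold_locales fact+
  define z where "z = (\<Sum>i = 1..n. X i - T (X i))"
  define D where "D = (\<Sum>i = 1..n. (b i - a i)\<^sup>2)"
  show ?thesis
  \<comment> \<open>In the zero space every order interval is nonempty, so \<open>a i < b i\<close>
    cannot be inferred; there the claim is trivial.\<close>
  proof (cases "u = 0")
    case True
    have zero: "x = 0" for x :: 'a using unit_bound[of x] True by (metis abs_le_zero_iff scaleR_zero_right)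
    have "v \<le> w" for v w :: 'a using zero[of v] zero[of w] by simp
    then show ?thesis .
  next
    case False
    \<comment> \<open>The interval contains \<open>X i\<close>; with \<open>u\<close> nonzero this
      excludes \<open>b i < a i\<close>.\<close>
    have ab: "a i < b i" if i: "i \<in> {1..n}" for i
    proof (rule ccontr)
      assume "\<not> a i < b i"
      with assms(8)[OF i] have ba: "b i < a i" by simp
      have "a i *\<^sub>R u \<le> b i *\<^sub>R u" using assms(7)[OF i] by auto
      then have "(a i - b i) *\<^sub>R u \<le> 0" by (simp add: scaleR_diff_left)
      then have "u \<le> 0" using ba by (simp add: le_iff_characters character_simps mult_le_0_iff)
      with False unit_nonneg show False by simp
    qed
    have D: "0 < D" unfolding D_def using ab assms(5) by (intro sum_pos) fastforce+
    \<comment> \<open>The minimiser of \<open>l^2 D / 8 - l t\<close>, with minimum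
      \<open>- 2 t^2 / D\<close>.\<close>
    define l where "l = 4 * t / D"
    have l: "0 \<le> l" using D assms(9) by (simp add: l_def)
    have "T (component (z - t *\<^sub>R u)) \<le> T (exp (- (l * t)) *\<^sub>R unit_exp (l *\<^sub>R z))"
      by (intro T_mono component_le_exp l)
    also have "\<dots> = exp (- (l * t)) *\<^sub>R T (unit_exp (l *\<^sub>R z))" by (rule T_scale)
    also have "\<dots> \<le> exp (- (l * t)) *\<^sub>R (exp (l\<^sup>2 * D / 8) *\<^sub>R u)"
      unfolding z_def D_def using assms(6,7) ab l
      by (intro scaleR_left_mono T_unit_exp_sum_bound) auto
    also have "\<dots> = exp (- (l * t) + l\<^sup>2 * D / 8) *\<^sub>R u"
      by (simp only: exp_add scaleR_scaleR)
    also have "- (l * t) + l\<^sup>2 * D / 8 = - (2 * t\<^sup>2 / D)"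
      using D by (simp add: l_def power2_eq_square field_simps)
    finally show ?thesis unfolding band_proj_pprt_unit z_def D_def .
  qed
qed

end
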